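(* Let $(G,\preceq)$ be a partially ordered abelian group, $\mathbb{K}$ a field of characteristic zero, $S$ a $G$-graded polynomial ring over $\mathbb{K}$ in finitely many variables, and $A=S/I$ an Artinian $G$-graded $\mathbb{K}$-algebra having a one-dimensional greatest element $A_\omega$. Then there exists a unique minimal $J$ containing $I$ such that $B=S/J$ is a Cox-Gorenstein graded $\mathbb{K}$-algebra. Moreover, the quotient is minimal in the sense that it preserves the pairings that were already perfect.
   Context: Graded algebras are always assumed to have degree-$0$ piece equal to $\mathbb{K}$; $I$ is a $G$-homogeneous ideal. Artinian means Artinian as an ungraded ring. $A$ has greatest element $A_\omega$ if $A_\omega\neq0$ and $g\preceq\omega$ for every $g$ with $A_g\neq0$. The pairings referred to are the multiplication pairings $A_g\times A_{\omega-g}\to A_\omega\simeq\mathbb{K}$ for $g\preceq\omega$. An Artinian graded quotient $B$ of $S$ is Cox-Gorenstein if there is an element $\omega'\in G$ with $\operatorname{soc}(B):=(0:_B\mathfrak m)=B_{\omega'}\simeq\mathbb{K}$, where $\mathfrak m\subset B$ is the ideal generated by the classes of the variables.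
   Formalization: "Unique minimal J" fails literally, e.g. I=(x²,xy,y³); here J is the unique Cox-Gorenstein ideal over I with socle degree ω and preserves perfect pairings; minimality among all Cox-Gorenstein ideals, and uniqueness among pairing-preserving ones, are stated only for variables of degree ≥ 0. *)

theory Defs
  imports "HOL-Library.Poly_Mapping" "HOL-Algebra.QuotRing" "HOL-Algebra.Embedded_Algebras"
begin

(* A polynomial over 'k is a finitely supported map from monomials to coefficients, and a
   monomial is a finitely supported map from variables to exponents; multiplication on poly_mapping is
   convolution, i.e. polynomial multiplication. *)
type_synonym ('v, 'k) mpoly = "('v \<Rightarrow>\<^sub>0 nat) \<Rightarrow>\<^sub>0 'k"

definition poly_ring :: "'v set \<Rightarrow> ('v, 'k::field) mpoly ring" where
  "poly_ring X = \<lparr> carrier = {p. \<forall>m \<in> Poly_Mapping.keys p. Poly_Mapping.keys m \<subseteq> X},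
     mult = (*), one = 1, zero = 0, add = (+) \<rparr>"

definition const :: "'k::field \<Rightarrow> ('v, 'k) mpoly" where
  "const c = Poly_Mapping.single 0 c"

definition var :: "'v \<Rightarrow> ('v, 'k::field) mpoly" where
  "var v = Poly_Mapping.single (Poly_Mapping.single v 1) 1"

(* The inner sum is the multiple (exponent of v) times d v in the abelian group. *)
definition mdeg :: "('v \<Rightarrow> 'g::ab_group_add) \<Rightarrow> ('v \<Rightarrow>\<^sub>0 nat) \<Rightarrow> 'g" where
  "mdeg d m = (\<Sum>v \<in> Poly_Mapping.keys m. \<Sum>i < Poly_Mapping.lookup m v. d v)"

definition hcomp :: "('v \<Rightarrow> 'g::ab_group_add) \<Rightarrow> 'g \<Rightarrow> ('v, 'k::field) mpoly \<Rightarrow> ('v, 'k) mpoly" where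
  "hcomp d g p =
     (\<Sum>m \<in> {m \<in> Poly_Mapping.keys p. mdeg d m = g}. Poly_Mapping.single m (Poly_Mapping.lookup p m))"

definition poly_piece :: "'v set \<Rightarrow> ('v \<Rightarrow> 'g::ab_group_add) \<Rightarrow> 'g \<Rightarrow> ('v, 'k::field) mpoly set" where
  "poly_piece X d g = {p \<in> carrier (poly_ring X). \<forall>m \<in> Poly_Mapping.keys p. mdeg d m = g}"

definition homogeneous_ideal ::
  "'v set \<Rightarrow> ('v \<Rightarrow> 'g::ab_group_add) \<Rightarrow> ('v, 'k::field) mpoly set \<Rightarrow> bool" where
  "homogeneous_ideal X d I \<longleftrightarrow>
     ideal I (poly_ring X) \<and> (\<forall>p \<in> I. \<forall>g. hcomp d g p \<in> I)"

definition artinian_ring :: "('a, 'b) ring_scheme \<Rightarrow> bool" where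
  "artinian_ring R \<longleftrightarrow>
     (\<forall>C :: nat \<Rightarrow> 'a set. (\<forall>n. ideal (C n) R \<and> C (Suc n) \<subseteq> C n) \<longrightarrow>
        (\<exists>n. \<forall>k \<ge> n. C k = C n))"

abbreviation quot :: "'v set \<Rightarrow> ('v, 'k::field) mpoly set \<Rightarrow> ('v, 'k) mpoly set ring" where
  "quot X I \<equiv> poly_ring X Quot I"

definition cls :: "'v set \<Rightarrow> ('v, 'k::field) mpoly set \<Rightarrow> ('v, 'k) mpoly \<Rightarrow> ('v, 'k) mpoly set" where
  "cls X I p = I +>\<^bsub>poly_ring X\<^esub> p"

definition piece :: "'v set \<Rightarrow> ('v \<Rightarrow> 'g::ab_group_add) \<Rightarrow> ('v, 'k::field) mpoly set
    \<Rightarrow> 'g \<Rightarrow> ('v, 'k) mpoly set set" where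
  "piece X d I g = cls X I ` poly_piece X d g"

definition scalars :: "'v set \<Rightarrow> ('v, 'k::field) mpoly set \<Rightarrow> ('v, 'k) mpoly set set" where
  "scalars X I = cls X I ` range const"

(* dimension is the library's vector space dimension over a subfield of a ring; scalars X I is
   the copy of the ground field in S/I whenever I is a proper ideal. *)
definition one_dimensional :: "'v set \<Rightarrow> ('v, 'k::field) mpoly set \<Rightarrow> ('v, 'k) mpoly set set \<Rightarrow> bool" where
  "one_dimensional X I V \<longleftrightarrow> ring.dimension (quot X I) 1 (scalars X I) V"

definition greatest_piece :: "'v set \<Rightarrow> ('v \<Rightarrow> 'g::ordered_ab_group_add) \<Rightarrow> ('v, 'k::field) mpoly set
    \<Rightarrow> 'g \<Rightarrow> bool" where
  "greatest_piece X d I \<omega> \<longleftrightarrow>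
     piece X d I \<omega> \<noteq> {\<zero>\<^bsub>quot X I\<^esub>} \<and>
     (\<forall>g. piece X d I g \<noteq> {\<zero>\<^bsub>quot X I\<^esub>} \<longrightarrow> g \<le> \<omega>)"

definition max_ideal :: "'v set \<Rightarrow> ('v, 'k::field) mpoly set \<Rightarrow> ('v, 'k) mpoly set set" where
  "max_ideal X J = Idl\<^bsub>quot X J\<^esub> ((\<lambda>v. cls X J (var v)) ` X)"

definition socle :: "'v set \<Rightarrow> ('v, 'k::field) mpoly set \<Rightarrow> ('v, 'k) mpoly set set" where
  "socle X J = {b \<in> carrier (quot X J).
     \<forall>a \<in> max_ideal X J. a \<otimes>\<^bsub>quot X J\<^esub> b = \<zero>\<^bsub>quot X J\<^esub>}"

definition cox_gorenstein_at :: "'v set \<Rightarrow> ('v \<Rightarrow> 'g::ab_group_add) \<Rightarrow> 'g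
    \<Rightarrow> ('v, 'k::field) mpoly set \<Rightarrow> bool" where
  "cox_gorenstein_at X d \<omega> J \<longleftrightarrow>
     homogeneous_ideal X d J \<and> artinian_ring (quot X J) \<and>
     socle X J = piece X d J \<omega> \<and> one_dimensional X J (piece X d J \<omega>)"

definition cox_gorenstein :: "'v set \<Rightarrow> ('v \<Rightarrow> 'g::ab_group_add)
    \<Rightarrow> ('v, 'k::field) mpoly set \<Rightarrow> bool" where
  "cox_gorenstein X d J \<longleftrightarrow> (\<exists>\<omega>. cox_gorenstein_at X d \<omega> J)"

definition linear_between :: "'v set \<Rightarrow> ('v, 'k::field) mpoly set \<Rightarrow> ('v, 'k) mpoly set set
    \<Rightarrow> ('v, 'k) mpoly set set \<Rightarrow> (('v, 'k) mpoly set \<Rightarrow> ('v, 'k) mpoly set) \<Rightarrow> bool" where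
  "linear_between X I V W l \<longleftrightarrow>
     (\<forall>x \<in> V. l x \<in> W) \<and>
     (\<forall>x \<in> V. \<forall>y \<in> V. l (x \<oplus>\<^bsub>quot X I\<^esub> y) = l x \<oplus>\<^bsub>quot X I\<^esub> l y) \<and>
     (\<forall>c \<in> scalars X I. \<forall>x \<in> V. l (c \<otimes>\<^bsub>quot X I\<^esub> x) = c \<otimes>\<^bsub>quot X I\<^esub> l x)"

(* V -> Hom(W, T) and W -> Hom(V, T) are bijective, where V, W, T are the pieces of S/I of
   degrees g, \<omega> - g, \<omega>.  For T of dimension one this says that the pairing is perfect. *)
definition perfect_pairing :: "'v set \<Rightarrow> ('v \<Rightarrow> 'g::ab_group_add) \<Rightarrow> ('v, 'k::field) mpoly set
    \<Rightarrow> 'g \<Rightarrow> 'g \<Rightarrow> bool" where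
  "perfect_pairing X d I \<omega> g \<longleftrightarrow>
     (let V = piece X d I g; W = piece X d I (\<omega> - g); T = piece X d I \<omega> in
       (\<forall>l. linear_between X I W T l \<longrightarrow>
          (\<exists>!a. a \<in> V \<and> (\<forall>b \<in> W. l b = a \<otimes>\<^bsub>quot X I\<^esub> b))) \<and>
       (\<forall>l. linear_between X I V T l \<longrightarrow>
          (\<exists>!b. b \<in> W \<and> (\<forall>a \<in> V. l a = a \<otimes>\<^bsub>quot X I\<^esub> b))))"

(* For I \<subseteq> J, the set sum of J with a coset p + I is p + J, so this map is the canonical
   projection S/I -> S/J. *)
definition proj :: "'v set \<Rightarrow> ('v, 'k::field) mpoly set \<Rightarrow> ('v, 'k) mpoly set \<Rightarrow> ('v, 'k) mpoly set" where
  "proj X J a = J <+>\<^bsub>poly_ring X\<^esub> a"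

(* Every perfect pairing of S/I into degree \<omega> is carried isomorphically by the projection onto
   the corresponding pairing of S/J, which is again perfect. *)
definition preserves_perfect_pairings :: "'v set \<Rightarrow> ('v \<Rightarrow> 'g::ordered_ab_group_add) \<Rightarrow> 'g
    \<Rightarrow> ('v, 'k::field) mpoly set \<Rightarrow> ('v, 'k) mpoly set \<Rightarrow> bool" where
  "preserves_perfect_pairings X d \<omega> I J \<longleftrightarrow>
     (\<forall>g \<le> \<omega>. perfect_pairing X d I \<omega> g \<longrightarrow>
        perfect_pairing X d J \<omega> g \<and>
        (\<forall>h \<in> {g, \<omega> - g, \<omega>}. bij_betw (proj X J) (piece X d I h) (piece X d J h)))"

end

theory Submission
  imports Defs
begin

text \<open>
  Let \<open>S\<close> be the polynomial ring, \<open>A = S/I\<close>, and compose multiplication on \<open>A\<close> with the projection onto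
  the line \<open>A\<^sub>\<omega>\<close>.  This is a symmetric bilinear form with \<open>(ab, c) = (a, bc)\<close>, so its radical is a
  homogeneous ideal, and the ideal sought is the preimage \<open>J\<close> of the radical in \<open>S\<close>
  (\<open>pairing_radical\<close>).  In degree \<open>g\<close> it consists of the elements orthogonal to \<open>A\<close> in degree \<open>\<omega> - g\<close>;
  in particular it equals \<open>I\<close> in degree \<open>\<omega>\<close>, and also in each degree that takes part in a perfect
  pairing.  Hence \<open>S/I\<close> and \<open>S/J\<close> agree in those degrees, and perfectness is transported along the
  projection (\<open>left_perfect_proj\<close>).

  The socle of \<open>S/J\<close> is its piece of degree \<open>\<omega>\<close> (\<open>cox_gorenstein_at_pairing_radical\<close>).  An element killed
  by all variables is orthogonal to everything without constant term, so its components outside degree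
  \<open>\<omega>\<close> lie in the radical.  Conversely, if a variable times an element of degree \<open>\<omega>\<close> were paired
  nontrivially with some \<open>q\<close>, then the product of the variable and \<open>q\<close> would have a nonzero component of
  degree \<open>0\<close>.  That component is a constant because \<open>S\<^sub>0 = K\<close>, and it has no constant term.

  For uniqueness (\<open>cox_gorenstein_at_unique\<close>), let \<open>S/J'\<close> be another such quotient with socle degree \<open>\<omega>\<close>.
  Its piece of degree \<open>\<omega>\<close> is a nonzero image of the line \<open>A\<^sub>\<omega>\<close>, so \<open>J'\<close> is \<open>I\<close> in degree \<open>\<omega>\<close>, whence
  \<open>J' \<subseteq> J\<close>.  In an Artinian graded quotient the variables are nilpotent (\<open>var_nilpotent\<close>), so every nonzero
  homogeneous element has a monomial multiple that is nonzero and in the socle (\<open>monomial_into_socle\<close>).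
  For an element of \<open>J\<close> outside \<open>J'\<close> this multiple would lie in \<open>J\<close> and in degree \<open>\<omega>\<close>, hence in
  \<open>I \<subseteq> J'\<close>, a contradiction.

  When the variables have nonnegative degrees, everything of the greatest degree \<open>\<omega>\<close> is killed by the
  variables.  A Cox-Gorenstein quotient of \<open>A\<close> in which degree \<open>\<omega>\<close> survives therefore has socle degree
  \<open>\<omega>\<close> (\<open>cox_gorenstein_at_greatest_degree\<close>).  Degree \<open>\<omega>\<close> survives if \<open>J' \<subseteq> J\<close>, and also if perfect
  pairings are preserved, because the pairing of \<open>A\<^sub>\<omega>\<close> with \<open>A\<^sub>0 = K\<close> is perfect (\<open>perfect_pairing_top\<close>).
\<close>

section \<open>The grading of the polynomial ring\<close>

abbreviation polys :: "'v set \<Rightarrow> ('v, 'k::field) mpoly set" where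
  "polys X \<equiv> carrier (poly_ring X)"

abbreviation monomial :: "('v \<Rightarrow>\<^sub>0 nat) \<Rightarrow> ('v, 'k::field) mpoly" where
  "monomial m \<equiv> Poly_Mapping.single m 1"

lemma mdeg_superset:
  assumes "finite A" "Poly_Mapping.keys m \<subseteq> A"
  shows "mdeg d m = (\<Sum>v\<in>A. \<Sum>i<Poly_Mapping.lookup m v. d v)"
  unfolding mdeg_def
  by (rule sum.mono_neutral_left) (use assms in \<open>auto simp: in_keys_iff\<close>)

lemma mdeg_add: "mdeg (d :: 'v \<Rightarrow> 'g::ab_group_add) (a + b) = mdeg d a + mdeg d b"
proof -
  let ?A = "Poly_Mapping.keys a \<union> Poly_Mapping.keys b"
  have multiple_add: "(\<Sum>i<m + n. c) = (\<Sum>i<m. c) + (\<Sum>i<n. c)" for m n :: nat and c :: 'g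
    by (induction n) (simp_all add: add.assoc)
  have "mdeg d (a + b) = (\<Sum>v\<in>?A. \<Sum>i<Poly_Mapping.lookup (a + b) v. d v)"
    by (rule mdeg_superset) (use Poly_Mapping.keys_add[of a b] in auto)
  moreover have "mdeg d a = (\<Sum>v\<in>?A. \<Sum>i<Poly_Mapping.lookup a v. d v)"
    by (rule mdeg_superset) auto
  moreover have "mdeg d b = (\<Sum>v\<in>?A. \<Sum>i<Poly_Mapping.lookup b v. d v)"
    by (rule mdeg_superset) auto
  ultimately show ?thesis
    by (simp add: lookup_add multiple_add sum.distrib)
qed

lemma mdeg_zero [simp]: "mdeg d 0 = 0"
  by (simp add: mdeg_def)

lemma mdeg_var [simp]: "mdeg d (Poly_Mapping.single v (Suc 0)) = d v"
  by (simp add: mdeg_def)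

lemma lookup_hcomp:
  "Poly_Mapping.lookup (hcomp d g p) m = (if mdeg d m = g then Poly_Mapping.lookup p m else 0)"
proof -
  let ?K = "{m \<in> Poly_Mapping.keys p. mdeg d m = g}"
  have "Poly_Mapping.lookup (hcomp d g p) m = (\<Sum>n\<in>?K. if n = m then Poly_Mapping.lookup p n else 0)"
    by (simp add: hcomp_def lookup_sum lookup_single when_def)
  also have "\<dots> = (if m \<in> ?K then Poly_Mapping.lookup p m else 0)"
    by (simp add: sum.delta)
  finally show ?thesis
    by (auto simp: in_keys_iff)
qed

lemma hcomp_add: "hcomp d g (p + q) = hcomp d g p + hcomp d g q"
  by (rule poly_mapping_eqI) (simp add: lookup_hcomp lookup_add)

lemma hcomp_minus: "hcomp d g (p - q) = hcomp d g p - hcomp d g q"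
  by (rule poly_mapping_eqI) (simp add: lookup_hcomp lookup_minus)

lemma hcomp_zero [simp]: "hcomp d g 0 = 0"
  by (rule poly_mapping_eqI) (simp add: lookup_hcomp)

lemma hcomp_single:
  "hcomp d g (Poly_Mapping.single m c) = (if mdeg d m = g then Poly_Mapping.single m c else 0)"
  by (rule poly_mapping_eqI) (auto simp: lookup_hcomp lookup_single when_def)

lemma sum_terms:
  fixes p :: "'a \<Rightarrow>\<^sub>0 'b::comm_monoid_add"
  shows "p = (\<Sum>m\<in>Poly_Mapping.keys p. Poly_Mapping.single m (Poly_Mapping.lookup p m))"
  by (rule poly_mapping_eqI)
    (simp add: lookup_sum lookup_single when_def sum.delta in_keys_iff)

lemma sum_hcomp: "p = (\<Sum>g\<in>mdeg d ` Poly_Mapping.keys p. hcomp d g p)"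
  by (rule poly_mapping_eqI) (auto simp: lookup_sum lookup_hcomp sum.delta in_keys_iff)

lemma mpoly_induct [case_names zero single add]:
  fixes p :: "'a \<Rightarrow>\<^sub>0 'b::comm_monoid_add"
  assumes "P 0" and "\<And>m c. P (Poly_Mapping.single m c)" and "\<And>p q. P p \<Longrightarrow> P q \<Longrightarrow> P (p + q)"
  shows "P p"
proof -
  have "P (\<Sum>m\<in>M. Poly_Mapping.single m (Poly_Mapping.lookup p m))" if "finite M" for M
    using that by induction (auto intro: assms)
  then show ?thesis
    using sum_terms[of p] by (metis finite_keys)
qed

text \<open>
  Both sides collect the products of a term of \<open>p\<close> of degree \<open>g\<close> with a term of \<open>q\<close> of degree
  \<open>w - g\<close>.  This is the form in which the grading enters everywhere: to move a homogeneous factor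
  out of a component.
\<close>
lemma hcomp_mult: "hcomp d w (hcomp d g p * q) = hcomp d g p * hcomp d (w - g) (q :: ('v, 'k::field) mpoly)"
proof (induction p rule: mpoly_induct)
  case (single m c)
  show ?case
  proof (induction q rule: mpoly_induct)
    case (single n e)
    then show ?case
      by (auto simp: hcomp_single mult_single mdeg_add)
  qed (simp_all add: hcomp_add distrib_left)
qed (simp_all add: hcomp_add distrib_right)

lemma zero_in_polys [simp]: "0 \<in> polys X"
  and one_in_polys [simp]: "1 \<in> polys X"
  by (auto simp: poly_ring_def)

lemma single_in_polys: "Poly_Mapping.keys m \<subseteq> X \<Longrightarrow> Poly_Mapping.single m c \<in> polys X"
  by (simp add: poly_ring_def)

lemma const_in_polys [simp]: "const c \<in> polys X"
  by (simp add: const_def single_in_polys)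

lemma var_in_polys: "v \<in> X \<Longrightarrow> var v \<in> polys X"
  by (simp add: var_def single_in_polys)

lemma add_in_polys: "p \<in> polys X \<Longrightarrow> q \<in> polys X \<Longrightarrow> p + q \<in> polys X"
  using Poly_Mapping.keys_add[of p q] by (auto simp: poly_ring_def)

lemma uminus_in_polys: "p \<in> polys X \<Longrightarrow> - p \<in> polys X" for p :: "('v, 'k::field) mpoly"
  by (auto simp: poly_ring_def in_keys_iff)

lemma mult_in_polys:
  fixes p q :: "('v, 'k::field) mpoly"
  assumes "p \<in> polys X" "q \<in> polys X"
  shows "p * q \<in> polys X"
proof -
  have "Poly_Mapping.keys m \<subseteq> X" if "m \<in> Poly_Mapping.keys (p * q)" for m
  proof -
    obtain a b where "a \<in> Poly_Mapping.keys p" "b \<in> Poly_Mapping.keys q" "m = a + b"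
      using \<open>m \<in> Poly_Mapping.keys (p * q)\<close> keys_mult[of p q] by blast
    then show ?thesis
      using assms Poly_Mapping.keys_add[of a b] unfolding poly_ring_def by fastforce
  qed
  then show ?thesis
    by (simp add: poly_ring_def)
qed

lemma hcomp_in_piece: "p \<in> polys X \<Longrightarrow> hcomp d g p \<in> poly_piece X d g"
  by (auto simp: poly_piece_def poly_ring_def in_keys_iff lookup_hcomp split: if_splits)

lemma poly_piece_subset: "poly_piece X d g \<subseteq> polys X"
  by (auto simp: poly_piece_def)

lemma hcomp_in_polys: "p \<in> polys X \<Longrightarrow> hcomp d g p \<in> polys X"
  using hcomp_in_piece[of p X d g] poly_piece_subset by blast

lemma hcomp_piece:
  assumes "p \<in> poly_piece X d g"
  shows "hcomp d h p = (if h = g then p else 0)"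
  by (rule poly_mapping_eqI) (use assms in \<open>auto simp: lookup_hcomp poly_piece_def in_keys_iff\<close>)

lemma piece_mult_piece:
  fixes p q :: "('v, 'k::field) mpoly"
  assumes "p \<in> poly_piece X d g" "q \<in> poly_piece X d h"
  shows "p * q \<in> poly_piece X d (g + h)"
proof -
  have "p * q \<in> polys X"
    using assms by (simp add: poly_piece_def mult_in_polys)
  then have "hcomp d (g + h) (p * q) \<in> poly_piece X d (g + h)"
    by (rule hcomp_in_piece)
  moreover have "hcomp d (g + h) (p * q) = p * q"
    using hcomp_mult[of d "g + h" g p q]
    by (simp add: hcomp_piece[OF assms(1), of g] hcomp_piece[OF assms(2), of h])
  ultimately show ?thesis
    by simp
qed

lemma var_in_piece: "v \<in> X \<Longrightarrow> var v \<in> poly_piece X d (d v)"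
  by (simp add: poly_piece_def var_in_polys) (simp add: var_def)

lemma zero_in_piece [simp]: "0 \<in> poly_piece X d g"
  by (simp add: poly_piece_def)

lemma add_in_piece: "p \<in> poly_piece X d g \<Longrightarrow> q \<in> poly_piece X d g \<Longrightarrow> p + q \<in> poly_piece X d g"
  using Poly_Mapping.keys_add[of p q] by (auto simp: poly_piece_def add_in_polys)

lemma const_mult_in_piece:
  "p \<in> poly_piece X d g \<Longrightarrow> const c * p \<in> poly_piece X d g"
  using piece_mult_piece[of "const c" X d 0 p g]
  by (simp add: poly_piece_def const_def single_in_polys)

lemma const_zero [simp]: "const 0 = 0"
  and const_one [simp]: "const 1 = 1"
  and const_mult: "const a * const b = const (a * b)"
  and const_diff: "const a - const b = const (a - b)"
  by (simp_all add: const_def mult_single single_diff)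

section \<open>Quotients of the polynomial ring\<close>

lemma poly_ring_ops [simp]:
  "mult (poly_ring X) = (*)" "add (poly_ring X) = (+)"
  "one (poly_ring X) = 1" "zero (poly_ring X) = 0"
  by (simp_all add: poly_ring_def)

lemma cring_poly_ring: "cring (poly_ring X :: ('v, 'k::field) mpoly ring)"
proof (rule cringI)
  show "abelian_group (poly_ring X :: ('v, 'k) mpoly ring)"
  proof (rule abelian_groupI)
    fix p :: "('v, 'k) mpoly" assume "p \<in> carrier (poly_ring X)"
    then show "\<exists>q\<in>carrier (poly_ring X). q \<oplus>\<^bsub>poly_ring X\<^esub> p = \<zero>\<^bsub>poly_ring X\<^esub>"
      by (intro bexI[of _ "- p"] uminus_in_polys) simp_all
  qed (simp_all add: add_in_polys algebra_simps)
  show "comm_monoid (poly_ring X :: ('v, 'k) mpoly ring)"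
    by (rule comm_monoidI) (simp_all add: mult_in_polys algebra_simps)
qed (simp add: algebra_simps)

lemma cring_idealI:
  assumes "cring R" "I \<subseteq> carrier R" "\<zero>\<^bsub>R\<^esub> \<in> I"
    and "\<And>x y. x \<in> I \<Longrightarrow> y \<in> I \<Longrightarrow> x \<oplus>\<^bsub>R\<^esub> y \<in> I"
    and "\<And>a x. a \<in> carrier R \<Longrightarrow> x \<in> I \<Longrightarrow> a \<otimes>\<^bsub>R\<^esub> x \<in> I"
  shows "ideal I R"
proof -
  interpret cring R by fact
  have neg: "\<ominus>\<^bsub>R\<^esub> x \<in> I" if "x \<in> I" for x
  proof -
    have "\<ominus>\<^bsub>R\<^esub> x = (\<ominus>\<^bsub>R\<^esub> \<one>\<^bsub>R\<^esub>) \<otimes>\<^bsub>R\<^esub> x"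
      using that assms(2) by (simp add: l_minus subsetD)
    then show ?thesis
      using assms(5)[OF _ that] by simp
  qed
  show ?thesis
  proof (rule idealI)
    show "subgroup I (add_monoid R)"
      using assms(2-4) neg by (intro add.subgroupI) (auto simp: a_inv_def)
    fix a x assume "a \<in> I" "x \<in> carrier R"
    then show "x \<otimes>\<^bsub>R\<^esub> a \<in> I" "a \<otimes>\<^bsub>R\<^esub> x \<in> I"
      using assms(2,5) m_comm[of a x] by auto
  qed (rule ring_axioms)
qed

context
  fixes X :: "'v set" and J :: "('v, 'k::field) mpoly set"
  assumes J: "ideal J (poly_ring X)"
begin

interpretation J: ideal J "poly_ring X"
  by (rule J)

lemma ideal_subset: "J \<subseteq> polys X"
  using J.a_subset .

lemma ideal_zero [simp]: "0 \<in> J"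
  using additive_subgroup.zero_closed[OF J.is_additive_subgroup] by simp

lemma ideal_add: "p \<in> J \<Longrightarrow> q \<in> J \<Longrightarrow> p + q \<in> J"
  using additive_subgroup.a_closed[OF J.is_additive_subgroup, of p q] by simp

lemma ideal_mult: "p \<in> polys X \<Longrightarrow> q \<in> J \<Longrightarrow> p * q \<in> J"
  using J.I_l_closed[of q p] by simp

lemma ideal_mult_right: "p \<in> J \<Longrightarrow> q \<in> polys X \<Longrightarrow> p * q \<in> J"
  using ideal_mult[of q p] by (simp add: mult.commute)

lemma ideal_uminus: "p \<in> J \<Longrightarrow> - p \<in> J"
  using ideal_mult[of "- 1" p] uminus_in_polys[OF one_in_polys, of X] by simp

lemma ideal_diff: "p \<in> J \<Longrightarrow> q \<in> J \<Longrightarrow> p - q \<in> J"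
  using ideal_add[of p "- q"] ideal_uminus by simp

lemma ideal_sum: "(\<And>i. i \<in> M \<Longrightarrow> f i \<in> J) \<Longrightarrow> sum f M \<in> J"
  by (induction M rule: infinite_finite_induct) (auto intro: ideal_add)

lemma ideal_diff_mem_iff: "p - q \<in> J \<Longrightarrow> p \<in> J \<longleftrightarrow> q \<in> J"
  using ideal_add[of "p - q" q] ideal_diff[of p "p - q"] by auto

lemma cls_eq: "cls X J p = {j + p | j. j \<in> J}"
  by (auto simp: cls_def a_r_coset_def')

lemma cls_eq_iff: "cls X J p = cls X J q \<longleftrightarrow> p - q \<in> J"
proof
  assume "cls X J p = cls X J q"
  moreover have "p \<in> cls X J p"
    unfolding cls_eq using ideal_zero by force
  ultimately obtain j where "j \<in> J" "p = j + q"
    by (auto simp: cls_eq)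
  then show "p - q \<in> J"
    by simp
next
  assume pq: "p - q \<in> J"
  have sub: "cls X J p \<subseteq> cls X J q" if "p - q \<in> J" for p q
  proof
    fix x assume "x \<in> cls X J p"
    then obtain j where "j \<in> J" "x = (j + (p - q)) + q"
      by (auto simp: cls_eq)
    then show "x \<in> cls X J q"
      unfolding cls_eq using that ideal_add by blast
  qed
  from sub[OF pq] sub[of q p] pq ideal_uminus[of "p - q"] show "cls X J p = cls X J q"
    by auto
qed

lemma quot_carrier: "carrier (quot X J) = cls X J ` polys X"
  by (auto simp: FactRing_def A_RCOSETS_def' cls_def)

lemma quot_zero: "\<zero>\<^bsub>quot X J\<^esub> = cls X J 0"
  by (simp add: FactRing_def cls_eq)

lemma quot_one: "\<one>\<^bsub>quot X J\<^esub> = cls X J 1"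
  by (simp add: FactRing_def cls_def)

lemma quot_add: "p \<in> polys X \<Longrightarrow> q \<in> polys X \<Longrightarrow>
    cls X J p \<oplus>\<^bsub>quot X J\<^esub> cls X J q = cls X J (p + q)"
  using J.a_rcos_sum[of p q] by (simp add: FactRing_def cls_def)

lemma quot_mult: "p \<in> polys X \<Longrightarrow> q \<in> polys X \<Longrightarrow>
    cls X J p \<otimes>\<^bsub>quot X J\<^esub> cls X J q = cls X J (p * q)"
  using J.rcoset_mult_add[of p q] by (simp add: FactRing_def cls_def)

lemma cls_eq_zero_iff: "cls X J p = cls X J 0 \<longleftrightarrow> p \<in> J"
  by (simp add: cls_eq_iff)

lemma cring_quot: "cring (quot X J)"
  using J.quotient_is_cring[OF cring_poly_ring] .

lemma piece_subset_quot: "piece X d J g \<subseteq> carrier (quot X J)"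
  unfolding piece_def quot_carrier using poly_piece_subset by blast

lemma cls_mem_piece_iff:
  "cls X J p \<in> piece X d J g \<longleftrightarrow> (\<exists>s\<in>poly_piece X d g. p - s \<in> J)"
  by (simp add: piece_def image_iff cls_eq_iff)

lemma piece_trivial_iff:
  "piece X d J g = {\<zero>\<^bsub>quot X J\<^esub>} \<longleftrightarrow> poly_piece X d g \<subseteq> J"
proof -
  have "\<zero>\<^bsub>quot X J\<^esub> \<in> piece X d J g"
    unfolding quot_zero piece_def by (intro imageI zero_in_piece)
  then have "piece X d J g = {\<zero>\<^bsub>quot X J\<^esub>} \<longleftrightarrow> (\<forall>a\<in>piece X d J g. a = \<zero>\<^bsub>quot X J\<^esub>)"
    by blast
  then show ?thesis
    by (simp add: piece_def quot_zero cls_eq_zero_iff subset_eq)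
qed

text \<open>
  An extension of the zero space by one vector \<open>s\<close> consists of the multiples of \<open>s\<close>, and a scalar of the
  quotient is represented by a constant.
\<close>
lemma one_dimensional_piece_iff:
  "one_dimensional X J (piece X d J g) \<longleftrightarrow>
     (\<exists>s\<in>poly_piece X d g. s \<notin> J \<and> (\<forall>p\<in>poly_piece X d g. \<exists>c. p - const c * s \<in> J))"
    (is "?L \<longleftrightarrow> ?R")
proof -
  interpret Q: cring "quot X J" by (rule cring_quot)
  have line: "Q.line_extension (scalars X J) (cls X J s) {\<zero>\<^bsub>quot X J\<^esub>} =
      {cls X J (const c * s) | c. True}" if "s \<in> polys X" for s
  proof -
    have "Q.line_extension (scalars X J) (cls X J s) {\<zero>\<^bsub>quot X J\<^esub>} =
        {cls X J (const c) \<otimes>\<^bsub>quot X J\<^esub> cls X J s \<oplus>\<^bsub>quot X J\<^esub> \<zero>\<^bsub>quot X J\<^esub> | c. True}"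
      by (rule Set.set_eqI) (simp add: Q.line_extension_mem_iff scalars_def)
    then show ?thesis
      using that by (simp add: quot_zero quot_mult quot_add mult_in_polys)
  qed
  show ?thesis
  proof
    assume ?L
    then have "Q.dimension (Suc 0) (scalars X J) (piece X d J g)"
      by (simp add: one_dimensional_def)
    then obtain v E where v: "v \<in> carrier (quot X J)" "v \<notin> E"
      and E: "Q.dimension 0 (scalars X J) E"
      and V: "piece X d J g = Q.line_extension (scalars X J) v E"
      by (cases rule: Q.dimension.cases) auto
    from E have E0: "E = {\<zero>\<^bsub>quot X J\<^esub>}"
      by (cases rule: Q.dimension.cases) auto
    obtain s0 where s0: "s0 \<in> polys X" "v = cls X J s0"
      using v(1) quot_carrier by blast
    have V': "piece X d J g = {cls X J (const c * s0) | c. True}"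
      using V E0 line s0 by simp
    then have "cls X J (const 1 * s0) \<in> piece X d J g"
      by blast
    then obtain s where s: "s \<in> poly_piece X d g" "v = cls X J s"
      using s0(2) unfolding piece_def by auto
    have "s \<notin> J"
      using v(2) E0 s(2) by (simp add: quot_zero cls_eq_zero_iff)
    moreover have "\<exists>c. p - const c * s \<in> J" if p: "p \<in> poly_piece X d g" for p
    proof -
      have "cls X J p \<in> piece X d J g"
        using p by (simp add: piece_def)
      then obtain c where "cls X J p = cls X J (const c * s0)"
        using V' by blast
      then have "p - const c * s0 \<in> J"
        by (simp add: cls_eq_iff)
      moreover have "const c * (s0 - s) \<in> J"
        using s0(2) s(2) by (intro ideal_mult) (simp_all flip: cls_eq_iff)
      ultimately have "(p - const c * s0) + const c * (s0 - s) \<in> J"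
        by (rule ideal_add)
      then show ?thesis
        by (intro exI[of _ c]) (simp add: algebra_simps)
    qed
    ultimately show ?R
      using s(1) by blast
  next
    assume ?R
    then obtain s where s: "s \<in> poly_piece X d g" "s \<notin> J"
      and span: "\<And>p. p \<in> poly_piece X d g \<Longrightarrow> \<exists>c. p - const c * s \<in> J"
      by blast
    have s_poly: "s \<in> polys X"
      using s(1) poly_piece_subset by blast
    have "\<exists>c. cls X J p = cls X J (const c * s)" if "p \<in> poly_piece X d g" for p
      using span[OF that] by (simp add: cls_eq_iff)
    then have "piece X d J g = {cls X J (const c * s) | c. True}"
      unfolding piece_def using const_mult_in_piece[OF s(1)] by blast
    then have "piece X d J g = Q.line_extension (scalars X J) (cls X J s) {\<zero>\<^bsub>quot X J\<^esub>}"
      using line[OF s_poly] by simp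
    moreover have "cls X J s \<notin> {\<zero>\<^bsub>quot X J\<^esub>}"
      using s(2) by (simp add: quot_zero cls_eq_zero_iff)
    ultimately show ?L
      unfolding one_dimensional_def
      using Q.Suc_dim[of "cls X J s" "{\<zero>\<^bsub>quot X J\<^esub>}" 0 "scalars X J"] s_poly
      by (simp add: quot_carrier)
  qed
qed

text \<open>
  The annihilator of a class is an ideal, so it contains the ideal generated by the variables as soon as
  it contains the variables.
\<close>
lemma socle_eq: "socle X J = cls X J ` {b \<in> polys X. \<forall>v\<in>X. var v * b \<in> J}"
proof -
  interpret Q: cring "quot X J" by (rule cring_quot)
  let ?V = "(\<lambda>v. cls X J (var v)) ` X"
  have V: "?V \<subseteq> carrier (quot X J)"
    by (auto simp: quot_carrier var_in_polys)
  have "(\<forall>a\<in>max_ideal X J. a \<otimes>\<^bsub>quot X J\<^esub> b = \<zero>\<^bsub>quot X J\<^esub>) \<longleftrightarrow>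
      (\<forall>a\<in>?V. a \<otimes>\<^bsub>quot X J\<^esub> b = \<zero>\<^bsub>quot X J\<^esub>)" if b: "b \<in> carrier (quot X J)" for b
  proof
    assume kills: "\<forall>a\<in>?V. a \<otimes>\<^bsub>quot X J\<^esub> b = \<zero>\<^bsub>quot X J\<^esub>"
    let ?Ann = "{a \<in> carrier (quot X J). a \<otimes>\<^bsub>quot X J\<^esub> b = \<zero>\<^bsub>quot X J\<^esub>}"
    have "ideal ?Ann (quot X J)"
      using b by (intro cring_idealI[OF cring_quot]) (auto simp: Q.l_distr Q.m_assoc)
    then have "max_ideal X J \<subseteq> ?Ann"
      unfolding max_ideal_def using kills V by (intro Q.genideal_minimal) auto
    then show "\<forall>a\<in>max_ideal X J. a \<otimes>\<^bsub>quot X J\<^esub> b = \<zero>\<^bsub>quot X J\<^esub>"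
      by blast
  next
    assume "\<forall>a\<in>max_ideal X J. a \<otimes>\<^bsub>quot X J\<^esub> b = \<zero>\<^bsub>quot X J\<^esub>"
    then show "\<forall>a\<in>?V. a \<otimes>\<^bsub>quot X J\<^esub> b = \<zero>\<^bsub>quot X J\<^esub>"
      using Q.genideal_self[OF V] unfolding max_ideal_def by blast
  qed
  then have "socle X J = {b \<in> carrier (quot X J). \<forall>a\<in>?V. a \<otimes>\<^bsub>quot X J\<^esub> b = \<zero>\<^bsub>quot X J\<^esub>}"
    unfolding socle_def by blast
  also have "\<dots> = cls X J ` {b \<in> polys X. \<forall>v\<in>X. cls X J (var v) \<otimes>\<^bsub>quot X J\<^esub> cls X J b = \<zero>\<^bsub>quot X J\<^esub>}"
    unfolding quot_carrier by blast
  also have "\<dots> = cls X J ` {b \<in> polys X. \<forall>v\<in>X. var v * b \<in> J}"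
    by (simp add: quot_zero quot_mult var_in_polys cls_eq_zero_iff cong: conj_cong)
  finally show ?thesis .
qed

lemma cls_mem_socle_iff:
  assumes "p \<in> polys X"
  shows "cls X J p \<in> socle X J \<longleftrightarrow> (\<forall>v\<in>X. var v * p \<in> J)"
proof
  assume "cls X J p \<in> socle X J"
  then obtain b where b: "p - b \<in> J" "\<forall>v\<in>X. var v * b \<in> J"
    by (auto simp: socle_eq cls_eq_iff)
  show "\<forall>v\<in>X. var v * p \<in> J"
  proof
    fix v assume v: "v \<in> X"
    have "var v * (p - b) \<in> J"
      using b(1) v by (intro ideal_mult var_in_polys)
    then have "var v * (p - b) + var v * b \<in> J"
      using b(2) v by (intro ideal_add) auto
    then show "var v * p \<in> J"
      by (simp add: algebra_simps)
  qed
qed (use assms socle_eq in auto)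

end

section \<open>Projections between quotients\<close>

context
  fixes X :: "'v set" and I J :: "('v, 'k::field) mpoly set"
  assumes I: "ideal I (poly_ring X)" and J: "ideal J (poly_ring X)" and IJ: "I \<subseteq> J"
begin

lemma proj_cls: "proj X J (cls X I p) = cls X J p"
proof
  show "proj X J (cls X I p) \<subseteq> cls X J p"
    using IJ ideal_add[OF J]
    by (fastforce simp: proj_def set_add_def' cls_eq[OF I] cls_eq[OF J] add.assoc[symmetric])
  show "cls X J p \<subseteq> proj X J (cls X I p)"
    using ideal_zero[OF I]
    by (fastforce simp: proj_def set_add_def' cls_eq[OF I] cls_eq[OF J])
qed

lemma proj_piece: "proj X J ` piece X d I g = piece X d J g"
  by (simp add: piece_def proj_cls image_image)

lemma proj_ring_hom: "ring_hom_ring (quot X I) (quot X J) (proj X J)"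
proof -
  interpret QI: cring "quot X I" by (rule cring_quot[OF I])
  interpret QJ: cring "quot X J" by (rule cring_quot[OF J])
  show ?thesis
    by (rule ring_hom_ringI2[OF QI.ring_axioms QJ.ring_axioms], rule ring_hom_memI;
        (simp only: quot_carrier[OF I] quot_carrier[OF J], elim imageE)?)
      (simp_all add: quot_add[OF I] quot_add[OF J] quot_mult[OF I] quot_mult[OF J]
        quot_one[OF I] quot_one[OF J] proj_cls mult_in_polys add_in_polys)
qed

lemma image_preimage_eq: "C \<subseteq> f ` A \<Longrightarrow> C = f ` {a \<in> A. f a \<in> C}"
  by auto

text \<open>
  A descending chain in the smaller quotient is the image of the chain of its preimages, since the
  projection is onto.
\<close>
lemma artinian_ring_quot_mono:
  assumes "artinian_ring (quot X I)"
  shows "artinian_ring (quot X J)"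
  unfolding artinian_ring_def
proof (intro allI impI)
  fix C :: "nat \<Rightarrow> ('v, 'k) mpoly set set"
  assume C: "\<forall>n. ideal (C n) (quot X J) \<and> C (Suc n) \<subseteq> C n"
  interpret P: ring_hom_ring "quot X I" "quot X J" "proj X J" by (rule proj_ring_hom)
  define D where "D n = {a \<in> carrier (quot X I). proj X J a \<in> C n}" for n
  have "ideal (D n) (quot X I) \<and> D (Suc n) \<subseteq> D n" for n
    using C P.ideal_vimage unfolding D_def by blast
  then obtain n where n: "\<forall>k\<ge>n. D k = D n"
    using assms unfolding artinian_ring_def by blast
  have "C k = proj X J ` D k" for k
  proof -
    have "C k \<subseteq> carrier (quot X J)"
      using C by (intro additive_subgroup.a_subset[OF ideal.axioms(1)]) (elim allE conjE)
    also have "carrier (quot X J) = proj X J ` carrier (quot X I)"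
      by (simp add: quot_carrier[OF I] quot_carrier[OF J] image_image proj_cls)
    finally show ?thesis
      unfolding D_def by (rule image_preimage_eq)
  qed
  then show "\<exists>n. \<forall>k\<ge>n. C k = C n"
    using n by metis
qed

lemma bij_betw_proj_piece_iff:
  "bij_betw (proj X J) (piece X d I g) (piece X d J g) \<longleftrightarrow> poly_piece X d g \<inter> J \<subseteq> I"
proof
  assume bij: "bij_betw (proj X J) (piece X d I g) (piece X d J g)"
  show "poly_piece X d g \<inter> J \<subseteq> I"
  proof
    fix p assume "p \<in> poly_piece X d g \<inter> J"
    then have "cls X I p \<in> piece X d I g" "cls X I 0 \<in> piece X d I g"
      and "proj X J (cls X I p) = proj X J (cls X I 0)"
      by (simp_all add: piece_def proj_cls cls_eq_zero_iff[OF J])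
    then have "cls X I p = cls X I 0"
      using bij by (meson bij_betw_imp_inj_on inj_onD)
    then show "p \<in> I"
      by (simp add: cls_eq_zero_iff[OF I])
  qed
next
  assume sub: "poly_piece X d g \<inter> J \<subseteq> I"
  have "inj_on (proj X J) (piece X d I g)"
  proof (rule inj_onI)
    fix a b assume "a \<in> piece X d I g" "b \<in> piece X d I g" "proj X J a = proj X J b"
    then obtain p q where pq: "p \<in> poly_piece X d g" "a = cls X I p"
        "q \<in> poly_piece X d g" "b = cls X I q" and "cls X J p = cls X J q"
      unfolding piece_def using proj_cls by blast
    then have "p - q \<in> J"
      by (simp add: cls_eq_iff[OF J])
    moreover have "p - q \<in> poly_piece X d g"
      using add_in_piece[OF pq(1) const_mult_in_piece[OF pq(3), of "- 1"]]
      by (simp add: const_def single_uminus)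
    ultimately show "a = b"
      unfolding pq cls_eq_iff[OF I] using sub by blast
  qed
  then show "bij_betw (proj X J) (piece X d I g) (piece X d J g)"
    by (simp add: bij_betw_def proj_piece)
qed

end

section \<open>Homogeneous ideals with Artinian quotient\<close>

lemma homogeneous_ideal_ideal: "homogeneous_ideal X d J \<Longrightarrow> ideal J (poly_ring X)"
  by (simp add: homogeneous_ideal_def)

lemma homogeneous_ideal_hcomp: "homogeneous_ideal X d J \<Longrightarrow> p \<in> J \<Longrightarrow> hcomp d g p \<in> J"
  by (simp add: homogeneous_ideal_def)

lemma homogeneous_ideal_memI:
  assumes J: "ideal J (poly_ring X)" and "\<And>g. hcomp d g p \<in> J"
  shows "p \<in> J"
  using ideal_sum[OF J, of "mdeg d ` Poly_Mapping.keys p" "\<lambda>g. hcomp d g p"] assms(2)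
    sum_hcomp[of p d] by simp

lemma lookup_var_mult_zero: "Poly_Mapping.lookup (var v * q) 0 = 0"
  for q :: "('v, 'k::field) mpoly"
proof -
  have "0 \<notin> Poly_Mapping.keys (var v * q)"
  proof
    assume "0 \<in> Poly_Mapping.keys (var v * q)"
    then obtain a b where ab: "0 = a + b" "a \<in> Poly_Mapping.keys (var v :: ('v, 'k) mpoly)"
      using subsetD[OF keys_mult] by blast
    from ab(2) have "a = Poly_Mapping.single v 1"
      by (simp add: var_def)
    then have "Poly_Mapping.lookup (Poly_Mapping.single v 1 + b) v = 0"
      using ab(1) by (metis lookup_zero)
    then show False
      by (simp add: lookup_add)
  qed
  then show ?thesis
    by (simp add: in_keys_iff)
qed

text \<open>
  If the constants are the only polynomials of degree zero, a variable has no cofactor of the opposite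
  degree: the product would be a constant, but its constant term vanishes.
\<close>
lemma hcomp_zero_var_mult:
  assumes S0: "(poly_piece X d 0 :: ('v, 'k::field) mpoly set) = range const"
    and "v \<in> X" "q \<in> polys X"
  shows "hcomp d 0 (var v * q :: ('v, 'k) mpoly) = 0"
proof -
  have "hcomp d 0 (var v * q) \<in> range const"
    using assms hcomp_in_piece[of "var v * q" X d 0] by (simp add: mult_in_polys var_in_polys)
  then obtain c where c: "hcomp d 0 (var v * q) = const c"
    by blast
  have "c = Poly_Mapping.lookup (hcomp d 0 (var v * q)) 0"
    by (simp add: c const_def)
  also have "\<dots> = 0"
    by (simp add: lookup_hcomp lookup_var_mult_zero)
  finally show ?thesis
    by (simp add: c)
qed

lemma degree_var_nonzero:
  assumes S0: "(poly_piece X d 0 :: ('v, 'k::field) mpoly set) = range const" and "v \<in> X"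
  shows "d v \<noteq> 0"
proof
  assume "d v = 0"
  then have "hcomp d 0 (var v * 1 :: ('v, 'k) mpoly) = var v"
    by (simp add: var_def hcomp_single)
  then have "(var v :: ('v, 'k) mpoly) = 0"
    using hcomp_zero_var_mult[OF S0 \<open>v \<in> X\<close> one_in_polys] by simp
  then have "Poly_Mapping.lookup (var v :: ('v, 'k) mpoly) (Poly_Mapping.single v 1) = 0"
    by (metis lookup_zero)
  then show False
    by (simp add: var_def)
qed

text \<open>
  The descending chain of the principal ideals of the powers of a variable \<open>x\<close> stops, so
  \<open>x ^ n * (1 - x * c)\<close> lies in the ideal for some \<open>n\<close> and \<open>c\<close>.  The component of \<open>1 - x * c\<close> of degree
  zero is \<open>1\<close>, so the component of that product in the degree of \<open>x ^ n\<close> is \<open>x ^ n\<close> itself.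
\<close>
lemma var_nilpotent:
  assumes J: "homogeneous_ideal X d (J :: ('v, 'k::field) mpoly set)"
    and art: "artinian_ring (quot X J)"
    and S0: "(poly_piece X d 0 :: ('v, 'k) mpoly set) = range const"
    and v: "v \<in> X"
  shows "\<exists>n. monomial (Poly_Mapping.single v n) \<in> J"
proof -
  let ?x = "\<lambda>n. monomial (Poly_Mapping.single v n) :: ('v, 'k) mpoly"
  note iJ = homogeneous_ideal_ideal[OF J]
  have x_poly: "?x n \<in> polys X" for n
    using v by (intro single_in_polys) auto
  have x_Suc: "?x (Suc n) = ?x n * var v" for n
    by (simp add: var_def mult_single flip: single_add)
  define C where "C n = cls X J ` {?x n * c | c. c \<in> polys X}" for n
  have C_ideal: "ideal (C n) (quot X J)" for n
  proof (rule cring_idealI[OF cring_quot[OF iJ]])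
    show "C n \<subseteq> carrier (quot X J)"
      unfolding C_def quot_carrier[OF iJ] by (intro image_mono) (auto intro: mult_in_polys x_poly)
    have "cls X J (?x n * 0) \<in> C n"
      unfolding C_def using zero_in_polys by blast
    then show "\<zero>\<^bsub>quot X J\<^esub> \<in> C n"
      by (simp add: quot_zero[OF iJ])
  next
    fix a b assume "a \<in> C n" "b \<in> C n"
    then obtain p q where pq: "p \<in> polys X" "q \<in> polys X"
      and ab: "a = cls X J (?x n * p)" "b = cls X J (?x n * q)"
      unfolding C_def by blast
    have "a \<oplus>\<^bsub>quot X J\<^esub> b = cls X J (?x n * (p + q))"
      using pq by (simp add: ab quot_add[OF iJ] mult_in_polys x_poly distrib_left)
    then show "a \<oplus>\<^bsub>quot X J\<^esub> b \<in> C n"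
      unfolding C_def using add_in_polys[OF pq] by blast
  next
    fix a b assume "a \<in> carrier (quot X J)" "b \<in> C n"
    then obtain p q where pq: "p \<in> polys X" "q \<in> polys X"
      and ab: "a = cls X J p" "b = cls X J (?x n * q)"
      unfolding C_def quot_carrier[OF iJ] by blast
    have "a \<otimes>\<^bsub>quot X J\<^esub> b = cls X J (?x n * (p * q))"
      using pq by (simp add: ab quot_mult[OF iJ] mult_in_polys x_poly mult_ac)
    then show "a \<otimes>\<^bsub>quot X J\<^esub> b \<in> C n"
      unfolding C_def using mult_in_polys[OF pq] by blast
  qed
  have C_desc: "C (Suc n) \<subseteq> C n" for n
    unfolding C_def x_Suc mult.assoc using mult_in_polys[OF var_in_polys[OF v]] by blast
  obtain n where "\<forall>k\<ge>n. C k = C n"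
    using art C_ideal C_desc unfolding artinian_ring_def by meson
  then have "C (Suc n) = C n"
    using le_SucI[OF order_refl] by blast
  moreover have "cls X J (?x n * 1) \<in> C n"
    unfolding C_def by (rule imageI) (use one_in_polys in blast)
  ultimately have "cls X J (?x n * 1) \<in> C (Suc n)"
    by simp
  then have "\<exists>c\<in>polys X. cls X J (?x n * 1) = cls X J (?x (Suc n) * c)"
    unfolding C_def by (elim imageE CollectE exE conjE) (rule bexI, simp_all only:)
  then obtain c where "c \<in> polys X" "cls X J (?x n * 1) = cls X J (?x (Suc n) * c)"
    by (elim bexE)
  then have c: "c \<in> polys X" "?x n - ?x (Suc n) * c \<in> J"
    by (simp_all add: cls_eq_iff[OF iJ])
  let ?g = "mdeg d (Poly_Mapping.single v n)"
  have x_hom: "hcomp d ?g (?x n) = ?x n"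
    by (simp add: hcomp_single)
  have "?x n - ?x (Suc n) * c = ?x n * (1 - var v * c)"
    by (simp add: x_Suc algebra_simps)
  moreover have "hcomp d ?g (?x n * (1 - var v * c)) = ?x n * hcomp d 0 (1 - var v * c)"
    using hcomp_mult[of d ?g ?g "?x n" "1 - var v * c"] by (simp add: x_hom)
  moreover have "hcomp d 0 (1 - var v * c) = 1"
    using hcomp_zero_var_mult[OF S0 v c(1)] hcomp_single[of d 0 0 "1 :: 'k"]
    by (simp add: hcomp_minus)
  ultimately have "hcomp d ?g (?x n - ?x (Suc n) * c) = ?x n"
    by simp
  then show ?thesis
    using homogeneous_ideal_hcomp[OF J c(2), of ?g] by auto
qed

text \<open>
  Nilpotency of the variables bounds the exponents of a monomial that does not kill \<open>p\<close> modulo the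
  ideal, so one of largest total degree exists; it carries \<open>p\<close> into the socle.
\<close>
lemma monomial_into_socle:
  assumes J: "homogeneous_ideal X d (J :: ('v, 'k::field) mpoly set)"
    and art: "artinian_ring (quot X J)"
    and S0: "(poly_piece X d 0 :: ('v, 'k) mpoly set) = range const"
    and X: "finite X" and p: "p \<in> polys X" "p \<notin> J"
  obtains m where "Poly_Mapping.keys m \<subseteq> X" "monomial m * p \<notin> J" "\<forall>v\<in>X. var v * (monomial m * p) \<in> J"
proof -
  note iJ = homogeneous_ideal_ideal[OF J]
  obtain N where N: "\<And>v. v \<in> X \<Longrightarrow> monomial (Poly_Mapping.single v (N v)) \<in> J"
    using var_nilpotent[OF J art S0] by metis
  define P where "P m \<longleftrightarrow> Poly_Mapping.keys m \<subseteq> X \<and> monomial m * p \<notin> J" for m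
  define size where "size m = (\<Sum>v\<in>X. Poly_Mapping.lookup m v)" for m :: "'v \<Rightarrow>\<^sub>0 nat"
  have exponent_bound: "Poly_Mapping.lookup m v < N v" if m: "P m" and v: "v \<in> X" for m v
  proof (rule ccontr)
    assume "\<not> Poly_Mapping.lookup m v < N v"
    then have split: "(m - Poly_Mapping.single v (N v)) + Poly_Mapping.single v (N v) = m" (is "?m' + _ = _")
      by (intro poly_mapping_eqI) (auto simp: lookup_add lookup_minus lookup_single when_def)
    have "Poly_Mapping.keys ?m' \<subseteq> X"
      using m by (fastforce simp: P_def in_keys_iff lookup_minus)
    then have "(p * monomial ?m') * monomial (Poly_Mapping.single v (N v)) \<in> J"
      using N[OF v] p(1) by (intro ideal_mult[OF iJ] mult_in_polys single_in_polys)
    also have "(p * monomial ?m') * monomial (Poly_Mapping.single v (N v)) =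
        (monomial ?m' * monomial (Poly_Mapping.single v (N v))) * p"
      by (simp only: mult_ac)
    also have "\<dots> = monomial m * p"
      by (simp only: mult_single split mult_1)
    finally show False
      using m by (simp add: P_def)
  qed
  have "size m \<le> (\<Sum>v\<in>X. N v)" if "P m" for m
    unfolding size_def using exponent_bound[OF that] by (intro sum_mono less_imp_le)
  then have "\<forall>m. P m \<longrightarrow> size m < Suc (\<Sum>v\<in>X. N v)"
    by (simp add: less_Suc_eq_le)
  moreover have "P 0"
    using p(2) by (simp add: P_def)
  ultimately have "\<exists>m. P m \<and> (\<forall>m'. P m' \<longrightarrow> size m' \<le> size m)"
    by (intro ex_has_greatest_nat)
  then obtain m where m: "P m" and max: "\<And>m'. P m' \<Longrightarrow> size m' \<le> size m"
    by blast
  have "var v * (monomial m * p) \<in> J" if v: "v \<in> X" for v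
  proof (rule ccontr)
    let ?m' = "Poly_Mapping.single v 1 + m"
    assume "var v * (monomial m * p) \<notin> J"
    then have "monomial ?m' * p \<notin> J"
      by (simp add: var_def mult_single flip: mult.assoc)
    then have "P ?m'"
      using m v Poly_Mapping.keys_add[of "Poly_Mapping.single v 1" m] by (auto simp: P_def)
    moreover have "size ?m' = Suc (size m)"
      using X v by (simp add: size_def lookup_add sum.distrib lookup_single when_def sum.delta)
    ultimately show False
      using max[of ?m'] by simp
  qed
  then show ?thesis
    using m that by (auto simp: P_def)
qed

section \<open>The radical of the pairings into the top degree\<close>

lemma cox_gorenstein_at_iff:
  "cox_gorenstein_at X d w J \<longleftrightarrow>
     homogeneous_ideal X d J \<and> artinian_ring (quot X J) \<and>
     (\<forall>b\<in>polys X. (\<forall>v\<in>X. var v * b \<in> J) \<longleftrightarrow> (\<exists>s\<in>poly_piece X d w. b - s \<in> J)) \<and>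
     (\<exists>s\<in>poly_piece X d w. s \<notin> J \<and> (\<forall>p\<in>poly_piece X d w. \<exists>c. p - const c * s \<in> J))"
proof (cases "homogeneous_ideal X d J")
  case True
  note J = homogeneous_ideal_ideal[OF True]
  have "socle X J \<subseteq> cls X J ` polys X" "piece X d J w \<subseteq> cls X J ` polys X"
    using piece_subset_quot[OF J] by (auto simp: socle_def quot_carrier[OF J])
  then have "socle X J = piece X d J w \<longleftrightarrow>
      (\<forall>b\<in>polys X. cls X J b \<in> socle X J \<longleftrightarrow> cls X J b \<in> piece X d J w)"
    by blast
  then show ?thesis
    by (simp add: cox_gorenstein_at_def one_dimensional_piece_iff[OF J] cls_mem_socle_iff[OF J]
        cls_mem_piece_iff[OF J])
qed (simp add: cox_gorenstein_at_def)

text \<open>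
  The polynomials whose class is orthogonal to the whole quotient under the form that sends a product
  to its component of degree \<open>w\<close>.  Letting \<open>q\<close> range over all polynomials, not only over the homogeneous
  ones of complementary degree, makes the closure under multiplication immediate.
\<close>
definition pairing_radical ::
  "'v set \<Rightarrow> ('v \<Rightarrow> 'g::ab_group_add) \<Rightarrow> 'g \<Rightarrow> ('v, 'k::field) mpoly set \<Rightarrow> ('v, 'k) mpoly set" where
  "pairing_radical X d w I = {p \<in> polys X. \<forall>q\<in>polys X. hcomp d w (p * q) \<in> I}"

context
  fixes X :: "'v set" and d :: "'v \<Rightarrow> 'g::ab_group_add" and I :: "('v, 'k::field) mpoly set"
  assumes I: "homogeneous_ideal X d I"
begin

lemmas ideal_I = homogeneous_ideal_ideal[OF I]

lemma pairing_radical_superset: "I \<subseteq> pairing_radical X d w I"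
  using ideal_subset[OF ideal_I] ideal_mult_right[OF ideal_I] homogeneous_ideal_hcomp[OF I]
  by (auto simp: pairing_radical_def)

lemma pairing_radical_homogeneous: "homogeneous_ideal X d (pairing_radical X d w I)"
  unfolding homogeneous_ideal_def
proof (intro conjI ballI allI)
  show "ideal (pairing_radical X d w I) (poly_ring X)"
  proof (rule cring_idealI[OF cring_poly_ring])
    fix p q :: "('v, 'k) mpoly" assume "p \<in> polys X" "q \<in> pairing_radical X d w I"
    then have "hcomp d w (q * (p * r)) \<in> I" if "r \<in> polys X" for r
      using that mult_in_polys by (auto simp: pairing_radical_def)
    then show "p \<otimes>\<^bsub>poly_ring X\<^esub> q \<in> pairing_radical X d w I"
      using \<open>p \<in> polys X\<close> \<open>q \<in> pairing_radical X d w I\<close>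
      by (auto simp: pairing_radical_def mult_in_polys mult_ac)
  qed (auto simp: pairing_radical_def add_in_polys distrib_right hcomp_add
      intro: ideal_add[OF ideal_I] ideal_zero[OF ideal_I])
next
  fix p g assume p: "p \<in> pairing_radical X d w I"
  have "hcomp d w (hcomp d g p * q) \<in> I" if q: "q \<in> polys X" for q
  proof -
    let ?q = "hcomp d (w - g) q"
    have "hcomp d w (?q * p) = ?q * hcomp d g p"
      using hcomp_mult[of d w "w - g" q p] by simp
    then have "hcomp d w (hcomp d g p * q) = hcomp d w (p * ?q)"
      using hcomp_mult[of d w g p q] by (simp add: mult.commute)
    then show ?thesis
      using p q by (simp add: pairing_radical_def hcomp_in_polys)
  qed
  then show "hcomp d g p \<in> pairing_radical X d w I"
    using p by (simp add: pairing_radical_def hcomp_in_polys)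
qed

text \<open>
  For a homogeneous element only the component of \<open>q\<close> of complementary degree contributes: in each degree
  the radical is the left kernel of one multiplication pairing.
\<close>
lemma piece_in_pairing_radical_iff:
  assumes p: "p \<in> poly_piece X d g"
  shows "p \<in> pairing_radical X d w I \<longleftrightarrow> (\<forall>q\<in>poly_piece X d (w - g). p * q \<in> I)"
proof -
  have p_hom: "hcomp d g p = p"
    using hcomp_piece[OF p] by simp
  have component: "hcomp d w (p * q) = p * hcomp d (w - g) q" for q
    using hcomp_mult[of d w g p q] by (simp only: p_hom)
  have "hcomp d (w - g) q = q" if "q \<in> poly_piece X d (w - g)" for q
    using hcomp_piece[OF that] by simp
  then show ?thesis
    using p poly_piece_subset hcomp_in_piece component unfolding pairing_radical_def
    by (smt (verit, best) mem_Collect_eq subsetD)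
qed

text \<open>Pairing an element of degree \<open>w\<close> with \<open>1\<close> returns the element itself.\<close>
lemma top_piece_inter_pairing_radical:
  assumes S0: "(poly_piece X d 0 :: ('v, 'k) mpoly set) = range const"
  shows "poly_piece X d w \<inter> pairing_radical X d w I \<subseteq> I"
proof
  fix p assume p: "p \<in> poly_piece X d w \<inter> pairing_radical X d w I"
  have "(1 :: ('v, 'k) mpoly) \<in> poly_piece X d (w - w)"
    using S0 const_one by (metis diff_self rangeI)
  then have "p * 1 \<in> I"
    using p piece_in_pairing_radical_iff[of p w w] by blast
  then show "p \<in> I"
    by simp
qed


text \<open>
  Modulo the radical, an element killed by the variables lies in degree \<open>w\<close>: a component of another
  degree is paired only with polynomials without constant term, and those kill it.  Conversely, everything
  of degree \<open>w\<close> is killed by each variable \<open>v\<close>, because no nonzero polynomial has degree \<open>- d v\<close>.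
\<close>
lemma cox_gorenstein_at_pairing_radical:
  assumes S0: "(poly_piece X d 0 :: ('v, 'k) mpoly set) = range const"
    and art: "artinian_ring (quot X I)"
    and one: "one_dimensional X I (piece X d I w)"
  shows "cox_gorenstein_at X d w (pairing_radical X d w I)"
  unfolding cox_gorenstein_at_iff
proof (intro conjI ballI iffI)
  let ?J = "pairing_radical X d w I"
  note J_hom = pairing_radical_homogeneous[of w]
  note J = homogeneous_ideal_ideal[OF J_hom]
  show "homogeneous_ideal X d ?J"
    by (rule J_hom)
  show "artinian_ring (quot X ?J)"
    by (rule artinian_ring_quot_mono[OF ideal_I J pairing_radical_superset art])
  obtain s where s: "s \<in> poly_piece X d w" "s \<notin> I"
    and span: "\<And>p. p \<in> poly_piece X d w \<Longrightarrow> \<exists>c. p - const c * s \<in> I"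
    using one unfolding one_dimensional_piece_iff[OF ideal_I] by blast
  show "\<exists>s\<in>poly_piece X d w. s \<notin> ?J \<and> (\<forall>p\<in>poly_piece X d w. \<exists>c. p - const c * s \<in> ?J)"
    using s span top_piece_inter_pairing_radical[OF S0] pairing_radical_superset by blast
next
  let ?J = "pairing_radical X d w I"
  note J_hom = pairing_radical_homogeneous[of w]
  note J = homogeneous_ideal_ideal[OF J_hom]
  \<comment> \<open>An element killed by the variables is congruent to its component of degree \<open>w\<close>.\<close>
  fix b assume b: "b \<in> polys X" and killed: "\<forall>v\<in>X. var v * b \<in> ?J"
  have no_constant_term: "q * b \<in> ?J" if q: "q \<in> polys X" and q0: "Poly_Mapping.lookup q 0 = 0" for q
  proof -
    have "Poly_Mapping.single m c * b \<in> ?J" if m: "Poly_Mapping.keys m \<subseteq> X" "m \<noteq> 0" for m c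
    proof -
      obtain v where v: "v \<in> Poly_Mapping.keys m"
        using m(2) by (metis keys_eq_empty ex_in_conv)
      then have split: "(m - Poly_Mapping.single v 1) + Poly_Mapping.single v 1 = m" (is "?m' + _ = _")
        by (intro poly_mapping_eqI)
          (auto simp: lookup_add lookup_minus lookup_single when_def in_keys_iff)
      have "Poly_Mapping.keys ?m' \<subseteq> X"
        using m(1) by (fastforce simp: in_keys_iff lookup_minus)
      then have "Poly_Mapping.single ?m' c * (var v * b) \<in> ?J"
        using killed v m(1) by (intro ideal_mult[OF J single_in_polys]) auto
      moreover have "Poly_Mapping.single ?m' c * (var v * b) = Poly_Mapping.single m c * b"
        by (simp only: mult.assoc[symmetric] var_def mult_single split mult_1_right)
      ultimately show ?thesis
        by simp
    qed
    moreover have "Poly_Mapping.keys m \<subseteq> X \<and> m \<noteq> 0" if "m \<in> Poly_Mapping.keys q" for m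
      using that q q0 by (auto simp: poly_ring_def in_keys_iff)
    ultimately have "(\<Sum>m\<in>Poly_Mapping.keys q. Poly_Mapping.single m (Poly_Mapping.lookup q m) * b) \<in> ?J"
      by (intro ideal_sum[OF J]) blast
    then show ?thesis
      using sum_terms[of q] by (simp flip: sum_distrib_right)
  qed
  have "hcomp d g (b - hcomp d w b) \<in> ?J" for g
  proof (cases "g = w")
    case True
    then show ?thesis
      by (simp add: hcomp_minus hcomp_piece[OF hcomp_in_piece[OF b]] ideal_zero[OF J])
  next
    case False
    have "hcomp d g b * q \<in> I" if q: "q \<in> poly_piece X d (w - g)" for q
    proof -
      have "Poly_Mapping.lookup q 0 = 0"
        using q False by (force simp: poly_piece_def in_keys_iff)
      then have "hcomp d w (q * b) \<in> poly_piece X d w \<inter> ?J"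
        using q poly_piece_subset no_constant_term b homogeneous_ideal_hcomp[OF J_hom]
        by (blast intro: hcomp_in_piece mult_in_polys)
      then have "hcomp d w (q * b) \<in> I"
        using top_piece_inter_pairing_radical[OF S0] by blast
      moreover have "hcomp d w (q * b) = q * hcomp d g b"
        using hcomp_mult[of d w "w - g" q b] hcomp_piece[OF q, of "w - g"] by simp
      ultimately show ?thesis
        by (simp add: mult.commute)
    qed
    then have "hcomp d g b \<in> ?J"
      using piece_in_pairing_radical_iff[OF hcomp_in_piece[OF b]] by blast
    then show ?thesis
      using False by (simp add: hcomp_minus hcomp_piece[OF hcomp_in_piece[OF b]])
  qed
  then have "b - hcomp d w b \<in> ?J"
    by (rule homogeneous_ideal_memI[OF J])
  then show "\<exists>s\<in>poly_piece X d w. b - s \<in> ?J"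
    using hcomp_in_piece[OF b] by blast
next
  let ?J = "pairing_radical X d w I"
  note J_hom = pairing_radical_homogeneous[of w]
  note J = homogeneous_ideal_ideal[OF J_hom]
  \<comment> \<open>An element congruent to one of degree \<open>w\<close> is killed by the variables.\<close>
  fix b v assume b: "b \<in> polys X" and v: "v \<in> X" and "\<exists>s\<in>poly_piece X d w. b - s \<in> ?J"
  then obtain s where s: "s \<in> poly_piece X d w" "b - s \<in> ?J"
    by blast
  have s_hom: "hcomp d w s = s"
    using hcomp_piece[OF s(1)] by simp
  have "hcomp d w ((var v * s) * q) = 0" if q: "q \<in> polys X" for q
  proof -
    have "hcomp d w (s * (var v * q)) = s * hcomp d 0 (var v * q)"
      using hcomp_mult[of d w w s "var v * q"] by (simp add: s_hom)
    also have "\<dots> = 0"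
      using hcomp_zero_var_mult[OF S0 v q] by simp
    finally show ?thesis
      by (simp only: mult_ac)
  qed
  then have "var v * s \<in> ?J"
    using s(1) v ideal_zero[OF ideal_I]
    by (simp add: pairing_radical_def poly_piece_def mult_in_polys var_in_polys)
  moreover have "var v * (b - s) \<in> ?J"
    using s(2) v by (intro ideal_mult[OF J] var_in_polys)
  ultimately have "var v * s + var v * (b - s) \<in> ?J"
    by (rule ideal_add[OF J])
  then show "var v * b \<in> ?J"
    by (simp add: algebra_simps)
qed

text \<open>
  A line that does not vanish in the quotient maps isomorphically onto its image.
\<close>
lemma top_piece_inter_subset:
  assumes J: "ideal J (poly_ring X)" and IJ: "I \<subseteq> J"
    and one: "one_dimensional X I (piece X d I w)"
    and t: "t \<in> poly_piece X d w" "t \<notin> J"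
  shows "poly_piece X d w \<inter> J \<subseteq> I"
proof
  fix p assume p: "p \<in> poly_piece X d w \<inter> J"
  obtain s where s: "s \<in> poly_piece X d w"
    and span: "\<And>p. p \<in> poly_piece X d w \<Longrightarrow> \<exists>c. p - const c * s \<in> I"
    using one unfolding one_dimensional_piece_iff[OF ideal_I] by blast
  obtain c where c: "p - const c * s \<in> I"
    using span p by blast
  obtain e where e: "t - const e * s \<in> I"
    using span t(1) by blast
  have "c = 0"
  proof (rule ccontr)
    assume "c \<noteq> 0"
    have "const c * s \<in> J"
      using ideal_diff_mem_iff[OF J, of p "const c * s"] c IJ p by blast
    then have "const (e / c) * (const c * s) \<in> J"
      by (rule ideal_mult[OF J const_in_polys])
    also have "const (e / c) * (const c * s) = const (e / c * c) * s"
      by (simp only: const_mult mult.assoc[symmetric])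
    finally have "const e * s \<in> J"
      using \<open>c \<noteq> 0\<close> by simp
    then show False
      using ideal_diff_mem_iff[OF J, of t "const e * s"] e IJ t(2) by blast
  qed
  then show "p \<in> I"
    using c by simp
qed

text \<open>
  Any other such ideal \<open>J\<close> agrees with \<open>I\<close> in degree \<open>w\<close>, which puts it inside the radical.  If it were
  smaller, some monomial would carry an element of the radical into the socle of \<open>S/J\<close> without
  killing it, that is, to a nonzero element of degree \<open>w\<close>; but in degree \<open>w\<close> the radical is \<open>I\<close>, which
  vanishes in \<open>S/J\<close>.
\<close>
lemma cox_gorenstein_at_unique:
  assumes X: "finite X"
    and S0: "(poly_piece X d 0 :: ('v, 'k) mpoly set) = range const"
    and one: "one_dimensional X I (piece X d I w)"
    and IJ: "I \<subseteq> J" and cg: "cox_gorenstein_at X d w J"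
  shows "J = pairing_radical X d w I"
proof
  let ?R = "pairing_radical X d w I"
  have J_hom: "homogeneous_ideal X d J" and art: "artinian_ring (quot X J)"
    and soc: "\<And>b. b \<in> polys X \<Longrightarrow> \<forall>v\<in>X. var v * b \<in> J \<Longrightarrow> \<exists>s\<in>poly_piece X d w. b - s \<in> J"
    using cg unfolding cox_gorenstein_at_iff by blast+
  obtain t where t: "t \<in> poly_piece X d w" "t \<notin> J"
    using cg unfolding cox_gorenstein_at_iff by blast
  note J = homogeneous_ideal_ideal[OF J_hom]
  note R_hom = pairing_radical_homogeneous[of w]
  note R = homogeneous_ideal_ideal[OF R_hom]
  have top: "poly_piece X d w \<inter> J \<subseteq> I"
    by (rule top_piece_inter_subset[OF J IJ one t])
  show "J \<subseteq> ?R"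
  proof
    fix p assume p: "p \<in> J"
    have p_poly: "p \<in> polys X"
      using p ideal_subset[OF J] by blast
    have "hcomp d w (p * q) \<in> poly_piece X d w \<inter> J" if "q \<in> polys X" for q
      using that p p_poly
      by (blast intro: hcomp_in_piece mult_in_polys homogeneous_ideal_hcomp[OF J_hom] ideal_mult_right[OF J])
    then show "p \<in> ?R"
      using p_poly top by (auto simp: pairing_radical_def)
  qed
  show "?R \<subseteq> J"
  proof
    fix p assume p: "p \<in> ?R"
    show "p \<in> J"
    proof (rule homogeneous_ideal_memI[OF J], rule ccontr)
      fix g assume notin: "hcomp d g p \<notin> J"
      let ?p = "hcomp d g p"
      have p_poly: "?p \<in> polys X" and p_R: "?p \<in> ?R"
        using p ideal_subset[OF R] by (auto intro: hcomp_in_polys homogeneous_ideal_hcomp[OF R_hom])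
      obtain m where m: "Poly_Mapping.keys m \<subseteq> X" "monomial m * ?p \<notin> J"
        and soc_m: "\<forall>v\<in>X. var v * (monomial m * ?p) \<in> J"
        using monomial_into_socle[OF J_hom art S0 X p_poly notin] by blast
      let ?b = "monomial m * ?p"
      have b_poly: "?b \<in> polys X"
        using m(1) p_poly by (intro mult_in_polys single_in_polys)
      obtain s where s: "s \<in> poly_piece X d w" "?b - s \<in> J"
        using soc[OF b_poly soc_m] by blast
      have b_piece: "?b \<in> poly_piece X d (mdeg d m + g)"
        using m(1) p ideal_subset[OF R]
        by (intro piece_mult_piece hcomp_in_piece) (auto simp: poly_piece_def single_in_polys)
      have "mdeg d m + g = w"
      proof (rule ccontr)
        assume "mdeg d m + g \<noteq> w"
        then have "hcomp d (mdeg d m + g) (?b - s) = ?b"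
          by (simp add: hcomp_minus hcomp_piece[OF b_piece] hcomp_piece[OF s(1)])
        then show False
          using homogeneous_ideal_hcomp[OF J_hom s(2), of "mdeg d m + g"] m(2) by simp
      qed
      moreover have "?b \<in> ?R"
        using m(1) p_R by (intro ideal_mult[OF R] single_in_polys)
      ultimately have "?b \<in> I"
        using b_piece top_piece_inter_pairing_radical[OF S0] by blast
      then show False
        using m(2) IJ by blast
    qed
  qed
qed

end

text \<open>
  A nonzero element of greatest degree is killed by all variables, hence lies in the socle, and the
  socle is concentrated in a single degree.
\<close>
lemma cox_gorenstein_at_greatest_degree:
  fixes d :: "'v \<Rightarrow> 'g::ordered_ab_group_add" and I :: "('v, 'k::field) mpoly set"
  assumes S0: "(poly_piece X d 0 :: ('v, 'k) mpoly set) = range const"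
    and I: "homogeneous_ideal X d I" and greatest: "greatest_piece X d I w"
    and nonneg: "\<forall>v\<in>X. 0 \<le> d v"
    and IJ: "I \<subseteq> J" and cg: "cox_gorenstein X d J"
    and s: "s \<in> poly_piece X d w" "s \<notin> J"
  shows "cox_gorenstein_at X d w J"
proof -
  obtain u where u: "cox_gorenstein_at X d u J"
    using cg by (auto simp: cox_gorenstein_def)
  have "var v * s \<in> I" if v: "v \<in> X" for v
  proof (rule ccontr)
    assume "var v * s \<notin> I"
    then have "\<not> poly_piece X d (d v + w) \<subseteq> I"
      using piece_mult_piece[OF var_in_piece[OF v] s(1)] by blast
    then have "piece X d I (d v + w) \<noteq> {\<zero>\<^bsub>quot X I\<^esub>}"
      by (simp add: piece_trivial_iff[OF homogeneous_ideal_ideal[OF I]])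
    then have "d v + w \<le> w"
      using greatest unfolding greatest_piece_def by (elim conjE allE impE)
    then have "d v = 0"
      using nonneg v by (simp add: antisym)
    then show False
      using degree_var_nonzero[OF S0 v] by simp
  qed
  then have "\<forall>v\<in>X. var v * s \<in> J"
    using IJ by blast
  moreover have "s \<in> polys X"
    using s(1) by (simp add: poly_piece_def)
  ultimately have "\<exists>t\<in>poly_piece X d u. s - t \<in> J"
    using u unfolding cox_gorenstein_at_iff by blast
  then obtain t where t: "t \<in> poly_piece X d u" "s - t \<in> J"
    by blast
  have "u = w"
  proof (rule ccontr)
    assume "u \<noteq> w"
    then have "hcomp d w (s - t) = s"
      by (simp add: hcomp_minus hcomp_piece[OF s(1)] hcomp_piece[OF t(1)])
    then show False
      using homogeneous_ideal_hcomp[of X d J "s - t" w] u t(2) s(2)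
      by (simp add: cox_gorenstein_at_def)
  qed
  then show ?thesis
    using u by simp
qed

section \<open>Perfect pairings\<close>

text \<open>
  One half of perfectness.  Since the ring is commutative, the other half is the same condition
  with the degrees \<open>g\<close> and \<open>w - g\<close> exchanged, so each argument about pairings is needed only once.
\<close>
definition left_perfect :: "'v set \<Rightarrow> ('v \<Rightarrow> 'g::ab_group_add) \<Rightarrow> ('v, 'k::field) mpoly set
    \<Rightarrow> 'g \<Rightarrow> 'g \<Rightarrow> bool" where
  "left_perfect X d I w g \<longleftrightarrow>
     (\<forall>l. linear_between X I (piece X d I (w - g)) (piece X d I w) l \<longrightarrow>
        (\<exists>!a. a \<in> piece X d I g \<and> (\<forall>b\<in>piece X d I (w - g). l b = a \<otimes>\<^bsub>quot X I\<^esub> b)))"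

context
  fixes X :: "'v set" and d :: "'v \<Rightarrow> 'g::ab_group_add" and I :: "('v, 'k::field) mpoly set"
  assumes I: "ideal I (poly_ring X)"
begin

interpretation Q: cring "quot X I"
  by (rule cring_quot[OF I])

lemma perfect_pairing_iff:
  "perfect_pairing X d I w g \<longleftrightarrow> left_perfect X d I w g \<and> left_perfect X d I w (w - g)"
proof -
  let ?V = "piece X d I g" and ?W = "piece X d I (w - g)"
  have comm: "a \<otimes>\<^bsub>quot X I\<^esub> b = b \<otimes>\<^bsub>quot X I\<^esub> a" if "a \<in> ?V" "b \<in> ?W" for a b
    using that by (intro Q.m_comm subsetD[OF piece_subset_quot[OF I]])
  have "(\<forall>a\<in>?V. l a = a \<otimes>\<^bsub>quot X I\<^esub> b) \<longleftrightarrow> (\<forall>a\<in>?V. l a = b \<otimes>\<^bsub>quot X I\<^esub> a)" if "b \<in> ?W" for l b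
    by (intro ball_cong refl) (simp only: comm[OF _ that])
  then have "(b \<in> ?W \<and> (\<forall>a\<in>?V. l a = a \<otimes>\<^bsub>quot X I\<^esub> b)) \<longleftrightarrow>
      (b \<in> ?W \<and> (\<forall>a\<in>?V. l a = b \<otimes>\<^bsub>quot X I\<^esub> a))" for l b
    by (rule conj_cong[OF refl])
  then show ?thesis
    by (simp only: perfect_pairing_def left_perfect_def Let_def diff_diff_eq2 add_diff_cancel_left')
qed

lemma scalars_subset_quot: "scalars X I \<subseteq> carrier (quot X I)"
  unfolding scalars_def quot_carrier[OF I] using const_in_polys by blast

lemma quot_piece_mult:
  assumes "a \<in> piece X d I g" "b \<in> piece X d I h"
  shows "a \<otimes>\<^bsub>quot X I\<^esub> b \<in> piece X d I (g + h)"
proof -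
  obtain p q where pq: "p \<in> poly_piece X d g" "a = cls X I p" "q \<in> poly_piece X d h" "b = cls X I q"
    using assms unfolding piece_def by (elim imageE)
  have "a \<otimes>\<^bsub>quot X I\<^esub> b = cls X I (p * q)"
    using pq by (simp add: quot_mult[OF I] poly_piece_def)
  then show ?thesis
    using piece_mult_piece[OF pq(1,3)] by (simp add: piece_def)
qed

lemma quot_piece_add:
  assumes "a \<in> piece X d I g" "b \<in> piece X d I g"
  shows "a \<oplus>\<^bsub>quot X I\<^esub> b \<in> piece X d I g"
proof -
  obtain p q where pq: "p \<in> poly_piece X d g" "a = cls X I p" "q \<in> poly_piece X d g" "b = cls X I q"
    using assms unfolding piece_def by (elim imageE)
  have "a \<oplus>\<^bsub>quot X I\<^esub> b = cls X I (p + q)"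
    using pq by (simp add: quot_add[OF I] poly_piece_def)
  then show ?thesis
    using add_in_piece[OF pq(1,3)] by (simp add: piece_def)
qed

lemma quot_piece_scale:
  assumes "c \<in> scalars X I" "b \<in> piece X d I g"
  shows "c \<otimes>\<^bsub>quot X I\<^esub> b \<in> piece X d I g"
proof -
  have "scalars X I \<subseteq> piece X d I 0"
    unfolding scalars_def piece_def
    by (auto simp: const_def poly_piece_def single_in_polys)
  then show ?thesis
    using quot_piece_mult[of c 0 b g] assms by auto
qed

text \<open>
  The zero map is represented only by zero, so no nonzero element of degree \<open>g\<close> is orthogonal to all of
  degree \<open>w - g\<close>.
\<close>
lemma left_perfect_inter_pairing_radical:
  assumes perf: "left_perfect X d I w g" and I_hom: "homogeneous_ideal X d I"
  shows "poly_piece X d g \<inter> pairing_radical X d w I \<subseteq> I"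
proof
  fix p assume p: "p \<in> poly_piece X d g \<inter> pairing_radical X d w I"
  let ?W = "piece X d I (w - g)"
  have zero_mem: "cls X I 0 \<in> piece X d I h" for h
    unfolding piece_def by (intro imageI zero_in_piece)
  have "linear_between X I ?W (piece X d I w) (\<lambda>_. \<zero>\<^bsub>quot X I\<^esub>)"
    using zero_mem[of w] scalars_subset_quot by (auto simp: linear_between_def quot_zero[OF I, symmetric])
  then have "\<exists>!a. a \<in> piece X d I g \<and> (\<forall>b\<in>?W. \<zero>\<^bsub>quot X I\<^esub> = a \<otimes>\<^bsub>quot X I\<^esub> b)"
    using perf unfolding left_perfect_def by blast
  moreover have "cls X I p \<in> piece X d I g"
    using p by (simp add: piece_def)
  moreover have "\<zero>\<^bsub>quot X I\<^esub> = cls X I p \<otimes>\<^bsub>quot X I\<^esub> b" if b: "b \<in> ?W" for b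
  proof -
    obtain q where q: "q \<in> poly_piece X d (w - g)" "b = cls X I q"
      using b unfolding piece_def by (elim imageE)
    have "p * q \<in> I"
      using p q(1) piece_in_pairing_radical_iff[OF I_hom] by blast
    then have "cls X I (p * q) = cls X I 0"
      by (simp add: cls_eq_zero_iff[OF I])
    then show ?thesis
      using p q by (simp add: quot_mult[OF I] quot_zero[OF I] poly_piece_def)
  qed
  moreover have "\<zero>\<^bsub>quot X I\<^esub> \<in> piece X d I g"
    using zero_mem by (simp add: quot_zero[OF I])
  moreover have "\<zero>\<^bsub>quot X I\<^esub> = \<zero>\<^bsub>quot X I\<^esub> \<otimes>\<^bsub>quot X I\<^esub> b" if "b \<in> ?W" for b
    by (simp add: subsetD[OF piece_subset_quot[OF I] that])
  ultimately have "cls X I p = \<zero>\<^bsub>quot X I\<^esub>"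
    by blast
  then show "p \<in> I"
    by (simp add: quot_zero[OF I] cls_eq_zero_iff[OF I])
qed

text \<open>
  The degree complementary to \<open>w\<close> contains only the scalars \<open>K\<close>.  Multiplication identifies
  \<open>Hom(K, T)\<close> with \<open>T\<close>, and \<open>Hom(T, T)\<close> with \<open>K\<close> when \<open>T\<close> is a line.
\<close>
lemma perfect_pairing_top:
  assumes S0: "(poly_piece X d 0 :: ('v, 'k) mpoly set) = range const"
    and one: "one_dimensional X I (piece X d I w)"
  shows "perfect_pairing X d I w w"
proof -
  have piece0: "piece X d I 0 = scalars X I"
    by (simp add: piece_def scalars_def S0)
  have T_sub: "piece X d I w \<subseteq> carrier (quot X I)"
    by (rule piece_subset_quot[OF I])
  have "left_perfect X d I w w"
    unfolding left_perfect_def diff_self piece0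
  proof (intro allI impI)
    fix l assume l: "linear_between X I (scalars X I) (piece X d I w) l"
    let ?e = "\<one>\<^bsub>quot X I\<^esub>"
    have e: "?e \<in> scalars X I"
      unfolding quot_one[OF I] scalars_def using const_one by (metis imageI rangeI)
    have l_e: "l ?e \<in> piece X d I w"
      using l e by (simp add: linear_between_def)
    show "\<exists>!a. a \<in> piece X d I w \<and> (\<forall>b\<in>scalars X I. l b = a \<otimes>\<^bsub>quot X I\<^esub> b)"
    proof (intro ex1I[of _ "l ?e"] conjI ballI)
      fix b assume b: "b \<in> scalars X I"
      have "l (b \<otimes>\<^bsub>quot X I\<^esub> ?e) = b \<otimes>\<^bsub>quot X I\<^esub> l ?e"
        using l b e by (simp add: linear_between_def)
      moreover have "b \<in> carrier (quot X I)" "l ?e \<in> carrier (quot X I)"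
        using b l_e scalars_subset_quot T_sub by blast+
      ultimately show "l b = l ?e \<otimes>\<^bsub>quot X I\<^esub> b"
        using Q.m_comm[of b "l ?e"] by simp
    next
      fix a assume a: "a \<in> piece X d I w \<and> (\<forall>b\<in>scalars X I. l b = a \<otimes>\<^bsub>quot X I\<^esub> b)"
      then have "l ?e = a \<otimes>\<^bsub>quot X I\<^esub> ?e"
        using e by blast
      moreover have "a \<in> carrier (quot X I)"
        using a T_sub by blast
      ultimately show "a = l ?e"
        by simp
    qed (rule l_e)
  qed
  moreover have "left_perfect X d I w 0"
    unfolding left_perfect_def diff_zero piece0
  proof (intro allI impI)
    fix l assume l: "linear_between X I (piece X d I w) (piece X d I w) l"
    obtain s where s: "s \<in> poly_piece X d w" "s \<notin> I"
      and span: "\<And>p. p \<in> poly_piece X d w \<Longrightarrow> \<exists>c. p - const c * s \<in> I"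
      using one unfolding one_dimensional_piece_iff[OF I] by blast
    have s_poly: "s \<in> polys X"
      using s(1) by (simp add: poly_piece_def)
    let ?s = "cls X I s"
    have s_T: "?s \<in> piece X d I w"
      using s(1) by (simp add: piece_def)
    have multiples: "\<exists>c. x = cls X I (const c) \<otimes>\<^bsub>quot X I\<^esub> ?s" if x: "x \<in> piece X d I w" for x
    proof -
      obtain p where p: "p \<in> poly_piece X d w" "x = cls X I p"
        using x unfolding piece_def by (elim imageE)
      obtain c where "p - const c * s \<in> I"
        using span[OF p(1)] by blast
      then show ?thesis
        using p(2) s_poly by (intro exI[of _ c]) (simp add: quot_mult[OF I] cls_eq_iff[OF I])
    qed
    have "l ?s \<in> piece X d I w"
      using l s_T by (simp add: linear_between_def)
    then obtain k where k: "l ?s = cls X I (const k) \<otimes>\<^bsub>quot X I\<^esub> ?s"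
      using multiples by blast
    show "\<exists>!a. a \<in> scalars X I \<and> (\<forall>b\<in>piece X d I w. l b = a \<otimes>\<^bsub>quot X I\<^esub> b)"
    proof (intro ex1I[of _ "cls X I (const k)"] conjI ballI)
      show "cls X I (const k) \<in> scalars X I"
        by (simp add: scalars_def)
    next
      fix b assume "b \<in> piece X d I w"
      then obtain c where c: "b = cls X I (const c) \<otimes>\<^bsub>quot X I\<^esub> ?s"
        using multiples by blast
      have "cls X I (const c) \<in> scalars X I"
        by (simp add: scalars_def)
      then have "l b = cls X I (const c) \<otimes>\<^bsub>quot X I\<^esub> l ?s"
        using l s_T by (simp add: linear_between_def c)
      also have "\<dots> = cls X I (const k) \<otimes>\<^bsub>quot X I\<^esub> b"
        using s_poly by (simp add: k c quot_mult[OF I] mult_in_polys mult_ac)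
      finally show "l b = cls X I (const k) \<otimes>\<^bsub>quot X I\<^esub> b" .
    next
      fix a assume a: "a \<in> scalars X I \<and> (\<forall>b\<in>piece X d I w. l b = a \<otimes>\<^bsub>quot X I\<^esub> b)"
      then obtain k' where k': "a = cls X I (const k')"
        unfolding scalars_def by blast
      have "l ?s = a \<otimes>\<^bsub>quot X I\<^esub> ?s"
        using a s_T by blast
      then have "cls X I (const k' * s) = cls X I (const k * s)"
        using s_poly by (simp add: k k' quot_mult[OF I])
      then have "const (k' - k) * s \<in> I"
        by (simp add: cls_eq_iff[OF I] left_diff_distrib flip: const_diff)
      then have "const (inverse (k' - k)) * (const (k' - k) * s) \<in> I"
        by (rule ideal_mult[OF I const_in_polys])
      also have "const (inverse (k' - k)) * (const (k' - k) * s) = const (inverse (k' - k) * (k' - k)) * s"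
        by (simp only: const_mult mult.assoc[symmetric])
      finally have "k' = k"
        using s(2) by (cases "k' = k") simp_all
      then show "a = cls X I (const k)"
        by (simp add: k')
    qed
  qed
  ultimately show ?thesis
    by (simp add: perfect_pairing_iff)
qed

end

text \<open>
  Conjugate a functional on the target by the isomorphisms, represent it there, and project the
  representing element.
\<close>
lemma left_perfect_proj:
  assumes I: "ideal I (poly_ring X)" and J: "ideal J (poly_ring X)" and IJ: "I \<subseteq> J"
    and bij: "\<And>h. h \<in> {g, w - g, w} \<Longrightarrow> bij_betw (proj X J) (piece X d I h) (piece X d J h)"
    and perf: "left_perfect X d I w g"
  shows "left_perfect X d J w g"
  unfolding left_perfect_def
proof (intro allI impI)
  fix l assume l: "linear_between X J (piece X d J (w - g)) (piece X d J w) l"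
  interpret P: ring_hom_ring "quot X I" "quot X J" "proj X J"
    by (rule proj_ring_hom[OF I J IJ])
  let ?\<pi> = "proj X J"
  let ?VI = "piece X d I g" and ?WI = "piece X d I (w - g)" and ?TI = "piece X d I w"
  let ?VJ = "piece X d J g" and ?WJ = "piece X d J (w - g)" and ?TJ = "piece X d J w"
  have carr: "a \<in> carrier (quot X I)" if "a \<in> piece X d I h" for a h
    using piece_subset_quot[OF I] that by (rule subsetD)
  have \<pi>_piece: "?\<pi> a \<in> piece X d J h" if "a \<in> piece X d I h" for a h
    using proj_piece[OF I J IJ, of d h] that by blast
  have \<pi>_scalars: "?\<pi> c \<in> scalars X J" if "c \<in> scalars X I" for c
    using that unfolding scalars_def by (auto simp: proj_cls[OF I J IJ])
  have inj_T: "x = y" if "x \<in> ?TI" "y \<in> ?TI" "?\<pi> x = ?\<pi> y" for x y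
    using bij[of w] that by (meson bij_betw_imp_inj_on inj_onD insertI1 insertI2)
  have pair_T: "a \<otimes>\<^bsub>quot X I\<^esub> b \<in> ?TI" if "a \<in> ?VI" "b \<in> ?WI" for a b
    using quot_piece_mult[OF I that] by simp
  define l' where "l' b = inv_into ?TI ?\<pi> (l (?\<pi> b))" for b
  have l'_T: "l' b \<in> ?TI" and \<pi>_l': "?\<pi> (l' b) = l (?\<pi> b)" if "b \<in> ?WI" for b
  proof -
    have "l (?\<pi> b) \<in> ?TJ"
      using l \<pi>_piece[OF that] by (simp add: linear_between_def)
    then have "l (?\<pi> b) \<in> ?\<pi> ` ?TI"
      by (simp add: proj_piece[OF I J IJ])
    then show "l' b \<in> ?TI" "?\<pi> (l' b) = l (?\<pi> b)"
      unfolding l'_def by (rule inv_into_into, rule f_inv_into_f)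
  qed
  have "linear_between X I ?WI ?TI l'"
    unfolding linear_between_def
  proof (intro conjI ballI)
    fix x y assume x: "x \<in> ?WI" and y: "y \<in> ?WI"
    have xy: "x \<oplus>\<^bsub>quot X I\<^esub> y \<in> ?WI"
      using quot_piece_add[OF I x y] .
    have "?\<pi> (l' (x \<oplus>\<^bsub>quot X I\<^esub> y)) = l (?\<pi> x \<oplus>\<^bsub>quot X J\<^esub> ?\<pi> y)"
      using \<pi>_l'[OF xy] by (simp add: carr[OF x] carr[OF y])
    also have "\<dots> = ?\<pi> (l' x) \<oplus>\<^bsub>quot X J\<^esub> ?\<pi> (l' y)"
      using l \<pi>_piece[OF x] \<pi>_piece[OF y] by (simp add: linear_between_def \<pi>_l'[OF x] \<pi>_l'[OF y])
    also have "\<dots> = ?\<pi> (l' x \<oplus>\<^bsub>quot X I\<^esub> l' y)"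
      by (simp add: carr[OF l'_T[OF x]] carr[OF l'_T[OF y]])
    finally show "l' (x \<oplus>\<^bsub>quot X I\<^esub> y) = l' x \<oplus>\<^bsub>quot X I\<^esub> l' y"
      by (rule inj_T[OF l'_T[OF xy] quot_piece_add[OF I l'_T[OF x] l'_T[OF y]]])
  next
    fix c x assume c: "c \<in> scalars X I" and x: "x \<in> ?WI"
    have cx: "c \<otimes>\<^bsub>quot X I\<^esub> x \<in> ?WI"
      using quot_piece_scale[OF I c x] .
    have c_carrier: "c \<in> carrier (quot X I)"
      using c scalars_subset_quot[OF I] by blast
    have "?\<pi> (l' (c \<otimes>\<^bsub>quot X I\<^esub> x)) = l (?\<pi> c \<otimes>\<^bsub>quot X J\<^esub> ?\<pi> x)"
      using \<pi>_l'[OF cx] by (simp add: c_carrier carr[OF x])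
    also have "\<dots> = ?\<pi> c \<otimes>\<^bsub>quot X J\<^esub> ?\<pi> (l' x)"
      using l \<pi>_piece[OF x] \<pi>_scalars[OF c] by (simp add: linear_between_def \<pi>_l'[OF x])
    also have "\<dots> = ?\<pi> (c \<otimes>\<^bsub>quot X I\<^esub> l' x)"
      by (simp add: c_carrier carr[OF l'_T[OF x]])
    finally show "l' (c \<otimes>\<^bsub>quot X I\<^esub> x) = c \<otimes>\<^bsub>quot X I\<^esub> l' x"
      by (rule inj_T[OF l'_T[OF cx] quot_piece_scale[OF I c l'_T[OF x]]])
  qed (rule l'_T)
  then have ex1: "\<exists>!a. a \<in> ?VI \<and> (\<forall>b\<in>?WI. l' b = a \<otimes>\<^bsub>quot X I\<^esub> b)"
    using perf unfolding left_perfect_def by blast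
  have represents: "(\<forall>b'\<in>?WJ. l b' = ?\<pi> a \<otimes>\<^bsub>quot X J\<^esub> b') \<longleftrightarrow> (\<forall>b\<in>?WI. l' b = a \<otimes>\<^bsub>quot X I\<^esub> b)"
    if a: "a \<in> ?VI" for a
  proof -
    have "l (?\<pi> b) = ?\<pi> a \<otimes>\<^bsub>quot X J\<^esub> ?\<pi> b \<longleftrightarrow> l' b = a \<otimes>\<^bsub>quot X I\<^esub> b" if b: "b \<in> ?WI" for b
    proof -
      have "?\<pi> (a \<otimes>\<^bsub>quot X I\<^esub> b) = ?\<pi> a \<otimes>\<^bsub>quot X J\<^esub> ?\<pi> b"
        by (rule P.hom_mult[OF carr[OF a] carr[OF b]])
      then show ?thesis
        using inj_T[OF l'_T[OF b] pair_T[OF a b]] \<pi>_l'[OF b] by metis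
    qed
    then show ?thesis
      by (simp add: proj_piece[OF I J IJ, of d "w - g", symmetric])
  qed
  have V: "?VJ = ?\<pi> ` ?VI"
    by (simp add: proj_piece[OF I J IJ])
  from ex1 represents show "\<exists>!a. a \<in> ?VJ \<and> (\<forall>b\<in>?WJ. l b = a \<otimes>\<^bsub>quot X J\<^esub> b)"
    unfolding V by (smt (verit, ccfv_SIG) image_iff)
qed

section \<open>The minimal Cox-Gorenstein quotient\<close>

theorem proposition4p23:
  fixes X :: "'v set"
    and d :: "'v \<Rightarrow> 'g::ordered_ab_group_add"
    and I :: "('v, 'k::field_char_0) mpoly set"
    and \<omega> :: 'g
  assumes "finite X"
    and "(poly_piece X d 0 :: ('v, 'k) mpoly set) = range const"
    and "homogeneous_ideal X d I"
    and "artinian_ring (quot X I)"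
    and "greatest_piece X d I \<omega>"
    and "one_dimensional X I (piece X d I \<omega>)"
  shows "\<exists>J. I \<subseteq> J \<and> cox_gorenstein_at X d \<omega> J \<and>
    preserves_perfect_pairings X d \<omega> I J \<and>
    (\<forall>J'. I \<subseteq> J' \<and> cox_gorenstein_at X d \<omega> J' \<longrightarrow> J' = J) \<and>
    ((\<forall>v \<in> X. 0 \<le> d v) \<longrightarrow>
      (\<forall>J'. I \<subseteq> J' \<and> cox_gorenstein X d J' \<and> J' \<subseteq> J \<longrightarrow> J' = J) \<and>
      (\<forall>J'. I \<subseteq> J' \<and> cox_gorenstein X d J' \<and>
             preserves_perfect_pairings X d \<omega> I J' \<longrightarrow> J' = J))"
proof (intro exI[of _ "pairing_radical X d \<omega> I"] conjI impI allI; (elim conjE)?)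
  let ?J = "pairing_radical X d \<omega> I"
  note I_hom = assms(3)
  note I = homogeneous_ideal_ideal[OF I_hom]
  note IJ = pairing_radical_superset[OF I_hom, of \<omega>]
  note J = homogeneous_ideal_ideal[OF pairing_radical_homogeneous[OF I_hom, of \<omega>]]
  show "I \<subseteq> ?J"
    by (rule IJ)
  show "cox_gorenstein_at X d \<omega> ?J"
    by (rule cox_gorenstein_at_pairing_radical[OF I_hom assms(2,4,6)])
  show unique: "J' = ?J" if "I \<subseteq> J'" "cox_gorenstein_at X d \<omega> J'" for J'
    by (rule cox_gorenstein_at_unique[OF I_hom assms(1,2,6) that])
  show "preserves_perfect_pairings X d \<omega> I ?J"
    unfolding preserves_perfect_pairings_def
  proof (intro allI impI)
    fix g assume "perfect_pairing X d I \<omega> g"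
    then have left: "left_perfect X d I \<omega> g" "left_perfect X d I \<omega> (\<omega> - g)"
      by (simp_all add: perfect_pairing_iff[OF I])
    have bij: "bij_betw (proj X ?J) (piece X d I h) (piece X d ?J h)" if "h \<in> {g, \<omega> - g, \<omega>}" for h
      unfolding bij_betw_proj_piece_iff[OF I J IJ]
      using that left_perfect_inter_pairing_radical[OF I left(1) I_hom]
        left_perfect_inter_pairing_radical[OF I left(2) I_hom]
        top_piece_inter_pairing_radical[OF I_hom assms(2)] by blast
    have "left_perfect X d ?J \<omega> g" "left_perfect X d ?J \<omega> (\<omega> - g)"
      using left by (auto intro!: left_perfect_proj[OF I J IJ] intro: bij)
    then show "perfect_pairing X d ?J \<omega> g \<and>
        (\<forall>h\<in>{g, \<omega> - g, \<omega>}. bij_betw (proj X ?J) (piece X d I h) (piece X d ?J h))"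
      using bij by (simp add: perfect_pairing_iff[OF J])
  qed
  obtain s where s: "s \<in> poly_piece X d \<omega>" "s \<notin> I"
    using assms(6) unfolding one_dimensional_piece_iff[OF I] by blast
  \<comment> \<open>Both minimality claims reduce to \<open>J'\<close> not meeting degree \<open>\<omega>\<close> outside \<open>I\<close>: then the socle degree
    of \<open>S/J'\<close> must be \<open>\<omega>\<close>, and uniqueness in that degree applies.\<close>
  have by_top_degree: "J' = ?J" if "\<forall>v\<in>X. 0 \<le> d v" "I \<subseteq> J'" "cox_gorenstein X d J'"
      "poly_piece X d \<omega> \<inter> J' \<subseteq> I" for J'
    using that s
    by (intro unique cox_gorenstein_at_greatest_degree[OF assms(2) I_hom assms(5)]) auto
  show "J' = ?J" if "\<forall>v\<in>X. 0 \<le> d v" "I \<subseteq> J'" "cox_gorenstein X d J'" "J' \<subseteq> ?J" for J'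
    using that top_piece_inter_pairing_radical[OF I_hom assms(2), of \<omega>]
    by (intro by_top_degree) auto
  show "J' = ?J" if nonneg: "\<forall>v\<in>X. 0 \<le> d v" and IJ': "I \<subseteq> J'" and cg: "cox_gorenstein X d J'"
    and preserves: "preserves_perfect_pairings X d \<omega> I J'" for J'
  proof (rule by_top_degree[OF nonneg IJ' cg])
    have J': "ideal J' (poly_ring X)"
      using cg by (auto simp: cox_gorenstein_def cox_gorenstein_at_def homogeneous_ideal_def)
    \<comment> \<open>The pairing of degree \<open>\<omega>\<close> with degree \<open>0\<close> is always perfect, so \<open>J'\<close> has to preserve it.\<close>
    have "bij_betw (proj X J') (piece X d I \<omega>) (piece X d J' \<omega>)"
      using preserves perfect_pairing_top[OF I assms(2,6)]
      unfolding preserves_perfect_pairings_def by blast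
    then show "poly_piece X d \<omega> \<inter> J' \<subseteq> I"
      by (simp add: bij_betw_proj_piece_iff[OF I J' IJ'])
  qed
qed

end
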